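(* Let $F$ be a probability distribution on the non-negative integers with $F(\{0\})=0$ and finite second moment. Then there exists $d_0$ such that for every even $d\ge d_0$ the cluster model with truncation level $d$ is well defined (all claimed clusters are almost surely finite) and the total length $T^d$ of all edges at the origin satisfies $\mathbb{E}[T^d]<\infty$.
   Context: Let $D_i$, $i\in\mathbb{Z}$, be i.i.d. with law $F$; attach $D_i$ stubs, labelled $1,\dots,D_i$, to vertex $i$. For even $d\in\mathbb{N}$ let $D_i^d=\max\{D_i-d,0\}$; stubs with label $>d$ are bad, others good; a vertex is high if $D_i>d$ and low otherwise. A vertex $i$ is claimed if $\sum_{k=i-m}^{i+m}D_k^d\ge m$ for some integer $m\ge1$; a cluster is a maximal set of consecutive claimed vertices. Cluster model (all random choices independent, uniform): Step 1: bad stubs are connected within their cluster $C$. If $C$ has one high vertex $i$, choose a random set of $D_i^d$ low vertices of $C$, take one stub from each and join them to the bad stubs of $i$. If $C$ has high vertices $i_1<\dots<i_h$, $h\ge2$: (i) if $h$ is even join $i_1$–$i_2$, $i_3$–$i_4$, \dots, $i_{h-1}$–$i_h$ using one bad stub from each; if $h$ is odd, with probability $1/2$ join the pairs $(i_1,i_2),\dots,(i_{h-2},i_{h-1})$ and otherwise the pairs $(i_2,i_3),\dots,(i_{h-1},i_h)$; (ii) with $b_r$ the number of still unconnected bad stubs in $C$, choose a random set of $b_r$ low vertices of $C$, take one stub from each and pair these randomly with the remaining bad stubs. Step 2: list all high vertices of $\mathbb{Z}$ in increasing order $\dots<i_{j}<i_{j+1}<\dots$; the $d$ good stubs of $i_j$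 are joined to good stubs at $i_{j+2},\dots,i_{j+d/2+1}$ and $i_{j-2},\dots,i_{j-d/2-1}$ (one edge to each). Step 3: the remaining unconnected stubs (all at low vertices) are connected by the Coin Toss rule: with $D'_i$ the number of remaining stubs at $i$ and $\Gamma_j=\{i:D'_i\ge j\}$, for each level $j$ the level-$j$ stubs get alternating directions right/left along $\Gamma_j$ (the direction at the first vertex $\ge0$ of $\Gamma_j$ chosen by a fair coin), and a level-$j$ stub at $i$ pointing right (left) is joined to the level-$j$ stub at the $(2j-1)$-th vertex of $\Gamma_j$ to the right (left) of $i$. The length of an edge $\{i,k\}$ is $|i-k|$; $T^d$ is the total length of all edges at vertex $0$. *)

theory Defs
  imports "HOL-Probability.Probability" "HOL-Library.Multiset"
begin

text \<open>Degree configuration: vertex i has D i stubs. Edges are stored as ordered pairs of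
  endpoints (x, y); the order carries no meaning.\<close>

type_synonym config = "int \<Rightarrow> nat"
type_synonym edge = "int \<times> int"

definition trunc :: "nat \<Rightarrow> config \<Rightarrow> int \<Rightarrow> nat" where
  "trunc d D i = D i - d"   \<comment> \<open>max (D i - d) 0, truncated nat subtraction\<close>

definition high :: "nat \<Rightarrow> config \<Rightarrow> int \<Rightarrow> bool" where
  "high d D i \<longleftrightarrow> D i > d"

definition claimed :: "nat \<Rightarrow> config \<Rightarrow> int \<Rightarrow> bool" where
  "claimed d D i \<longleftrightarrow>
     (\<exists>m::nat. m \<ge> 1 \<and> (\<Sum>k\<in>{i - int m..i + int m}. trunc d D k) \<ge> m)"

text \<open>The cluster containing i: maximal set of consecutive claimed vertices containing i
  (empty if i is not claimed).\<close>
definition clust :: "nat \<Rightarrow> config \<Rightarrow> int \<Rightarrow> int set" where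
  "clust d D i = {k. \<forall>l\<in>{min i k..max i k}. claimed d D l}"

definition highs :: "nat \<Rightarrow> config \<Rightarrow> int set \<Rightarrow> int list" where
  "highs d D C = sorted_list_of_set {i\<in>C. high d D i}"

definition lows :: "nat \<Rightarrow> config \<Rightarrow> int set \<Rightarrow> int set" where
  "lows d D C = {i\<in>C. \<not> high d D i}"

definition uniform_subset :: "int set \<Rightarrow> nat \<Rightarrow> int set pmf" where
  "uniform_subset L k =
     (let X = {S. S \<subseteq> L \<and> card S = k} in
      if finite X \<and> X \<noteq> {} then pmf_of_set X else return_pmf {})"

definition uniform_bij :: "int set \<Rightarrow> (int \<times> nat) set \<Rightarrow> (int \<Rightarrow> int \<times> nat) pmf" where
  "uniform_bij S R =
     (let X = {f. f \<in> S \<rightarrow>\<^sub>E R \<and> bij_betw f S R} in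
      if finite X \<and> X \<noteq> {} then pmf_of_set X else return_pmf (\<lambda>_. undefined))"

fun pairs_of :: "int list \<Rightarrow> edge list" where
  "pairs_of (a # b # rest) = (a, b) # pairs_of rest"
| "pairs_of _ = []"

text \<open>Bad stubs still unconnected after the pairing P of high vertices, relabelled
  (i, 1), ..., (i, r_i) at each high vertex i.\<close>
definition bad_remaining :: "nat \<Rightarrow> config \<Rightarrow> int list \<Rightarrow> edge list \<Rightarrow> (int \<times> nat) set" where
  "bad_remaining d D H P =
     {(i, l). i \<in> set H \<and> l \<in> {1..trunc d D i - length (filter (\<lambda>(x, y). x = i \<or> y = i) P)}}"

definition step1_cluster :: "nat \<Rightarrow> config \<Rightarrow> int set \<Rightarrow> edge multiset pmf" where
  "step1_cluster d D C =
     (let H = highs d D C; L = lows d D C in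
      if length H = 0 then return_pmf {#}
      else if length H = 1 then
        map_pmf (\<lambda>S. image_mset (\<lambda>k. (hd H, k)) (mset_set S)) (uniform_subset L (trunc d D (hd H)))
      else
        bind_pmf
          (if even (length H) then return_pmf (pairs_of H)
           else map_pmf (\<lambda>b. if b then pairs_of (butlast H) else pairs_of (tl H)) (bernoulli_pmf (1/2)))
          (\<lambda>P. let R = bad_remaining d D H P in
             bind_pmf (uniform_subset L (card R))
               (\<lambda>S. map_pmf (\<lambda>f. mset P + image_mset (\<lambda>k. (k, fst (f k))) (mset_set S))
                      (uniform_bij S R))))"

text \<open>Step-1 randomness is indexed by the left endpoint a of each cluster; independence across
  clusters is encoded by the product measure below.\<close>
definition step1_at :: "nat \<Rightarrow> config \<Rightarrow> int \<Rightarrow> edge multiset pmf" where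
  "step1_at d D a =
     (if claimed d D a \<and> finite (clust d D a) \<and> a = Min (clust d D a)
      then step1_cluster d D (clust d D a) else return_pmf {#})"

definition step1_space :: "nat \<Rightarrow> config \<Rightarrow> (int \<Rightarrow> edge multiset) measure" where
  "step1_space d D = PiM UNIV (\<lambda>a. measure_pmf (step1_at d D a))"

definition coin_space :: "(nat \<Rightarrow> bool) measure" where
  "coin_space = PiM UNIV (\<lambda>j. measure_pmf (bernoulli_pmf (1/2)))"

definition config_space :: "nat pmf \<Rightarrow> config measure" where
  "config_space F = PiM UNIV (\<lambda>i::int. measure_pmf F)"

definition edges1 :: "nat \<Rightarrow> config \<Rightarrow> (int \<Rightarrow> edge multiset) \<Rightarrow> int \<Rightarrow> edge multiset" where
  "edges1 d D S i = (if claimed d D i \<and> finite (clust d D i) then S (Min (clust d D i)) else {#})"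

definition deg1 :: "nat \<Rightarrow> config \<Rightarrow> (int \<Rightarrow> edge multiset) \<Rightarrow> int \<Rightarrow> nat" where
  "deg1 d D S i = size (filter_mset (\<lambda>(x, y). x = i \<or> y = i) (edges1 d D S i))"

text \<open>Remaining stubs after steps 1 and 2 (high vertices have none left).\<close>
definition Dprime :: "nat \<Rightarrow> config \<Rightarrow> (int \<Rightarrow> edge multiset) \<Rightarrow> int \<Rightarrow> nat" where
  "Dprime d D S i = (if high d D i then 0 else D i - deg1 d D S i)"

definition len_at :: "int \<Rightarrow> edge \<Rightarrow> nat" where
  "len_at v e = (case e of (x, y) \<Rightarrow>
      (if x = v then nat \<bar>y - x\<bar> else 0) + (if y = v then nat \<bar>x - y\<bar> else 0))"

text \<open>Step 2: high vertex b is joined to high vertex i iff b is the 2nd, ..., (d/2+1)-th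
  high vertex to the right or left of i, i.e. 1..d/2 high vertices lie strictly between.\<close>
definition step2_nbrs :: "nat \<Rightarrow> config \<Rightarrow> int \<Rightarrow> int set" where
  "step2_nbrs d D i = {b. high d D b \<and> b \<noteq> i \<and>
      card {x. high d D x \<and> min i b < x \<and> x < max i b} \<in> {1..d div 2}}"

definition Gamma :: "nat \<Rightarrow> config \<Rightarrow> (int \<Rightarrow> edge multiset) \<Rightarrow> nat \<Rightarrow> int set" where
  "Gamma d D S j = {i. Dprime d D S i \<ge> j}"

text \<open>Coin toss rule: direction (True = right) of the level-j stub at i in G = Gamma_j;
  directions alternate along G, the first vertex \<ge> 0 of G having direction c j.\<close>
definition ct_right :: "(nat \<Rightarrow> bool) \<Rightarrow> int set \<Rightarrow> nat \<Rightarrow> int \<Rightarrow> bool" where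
  "ct_right c G j i = (c j \<noteq> odd (if i \<ge> 0 then card (G \<inter> {0..<i}) else card (G \<inter> {i..<0})))"

text \<open>Length of the level-j coin-toss edge at i: distance to the (2j-1)-th vertex of G in the
  given direction.\<close>
definition ct_len :: "int set \<Rightarrow> nat \<Rightarrow> int \<Rightarrow> bool \<Rightarrow> nat" where
  "ct_len G j i right =
     (\<Sum>x\<in>{x\<in>G. if right then i < x \<and> card (G \<inter> {i<..<x}) = 2 * j - 2
                          else x < i \<and> card (G \<inter> {x<..<i}) = 2 * j - 2}. nat \<bar>x - i\<bar>)"

definition T :: "nat \<Rightarrow> config \<Rightarrow> (int \<Rightarrow> edge multiset) \<Rightarrow> (nat \<Rightarrow> bool) \<Rightarrow> nat" where
  "T d D S c =
     sum_mset (image_mset (len_at 0) (edges1 d D S 0))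
   + (if high d D 0 then (\<Sum>b\<in>step2_nbrs d D 0. nat \<bar>b\<bar>) else 0)
   + (if high d D 0 then 0
      else (\<Sum>j\<in>{1..Dprime d D S 0}.
              ct_len (Gamma d D S j) j 0 (ct_right c (Gamma d D S j) j 0)))"

definition expected_T :: "nat pmf \<Rightarrow> nat \<Rightarrow> ennreal" where
  "expected_T F d =
     (\<integral>\<^sup>+ D. (\<integral>\<^sup>+ S. (\<integral>\<^sup>+ c. ennreal (real (T d D S c)) \<partial>coin_space)
              \<partial>step1_space d D) \<partial>config_space F)"

end

theory Submission
  imports Defs
begin

text \<open>
  Write $X_i$ for the number of bad stubs at $i$. Let $w_\pm$ be the suprema of the random walks with
  steps $40 X_{\pm k} - 1$. Their drift is negative for large $d$, and since steps have a second moment,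
  Kingman's comparison of second moments along the Lindley recursion gives $w_\pm$ finite mean; they
  are independent of $X_0$. A Vitali covering of the claimed vertices in $[-N,N]$ by disjoint
  heavy windows shows deterministically that at most $N/2 + 10 X_0 + (w_+ + w_-)/4$ of them are claimed.
  Hence the cluster of the origin has radius $O(1 + X_0 + w_+ + w_-)$, and as the origin has at most
  $X_0 + 2$ step-1 edges, their total length has finite mean. Step 2 only needs gaps between
  independent high vertices. For step 3, unclaimed vertices with degree in $\{j,\dots,d\}$ belong to
  $\Gamma_j$ whatever happens in step 1; being unclaimed depends on the $X_i$ only, so the degrees
  of the (linearly many) unclaimed vertices are independent given the $X_i$, and
  except on an exponentially unlikely event enough of them lie in $\{j,\dots,d\}$.
\<close>

section \<open>Resampling a single degree\<close>

lemma prob_space_config [simp]: "prob_space (config_space F)"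
  unfolding config_space_def by (intro prob_space_PiM prob_space_measure_pmf)

lemma space_config [simp]: "space (config_space F) = UNIV"
  by (simp add: config_space_def space_PiM)

lemma measurable_config_coord [measurable]:
  "(\<lambda>D. D i) \<in> config_space F \<rightarrow>\<^sub>M count_space UNIV"
proof -
  have "(\<lambda>D. D i) \<in> config_space F \<rightarrow>\<^sub>M measure_pmf F"
    unfolding config_space_def by (rule measurable_component_singleton) simp
  then show ?thesis by simp
qed

lemma measurable_config_update [measurable]:
  "(\<lambda>(x, D). D(i := x)) \<in> measure_pmf F \<Otimes>\<^sub>M config_space F \<rightarrow>\<^sub>M config_space F"
proof -
  have "(\<lambda>z. (snd z)(i := fst z)) \<in> measure_pmf F \<Otimes>\<^sub>M config_space F \<rightarrow>\<^sub>M config_space F"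
    unfolding config_space_def
    by (rule measurable_fun_upd[where J=UNIV]) auto
  then show ?thesis by (simp add: case_prod_beta)
qed

text \<open>An independent copy of one coordinate leaves a product law unchanged: split off
  coordinate \<open>i\<close> and apply Fubini. Independence of the degrees enters below through
  this identity.\<close>

lemma nn_integral_config_resample:
  assumes [measurable]: "f \<in> borel_measurable (config_space F)"
  shows "(\<integral>\<^sup>+D. f D \<partial>config_space F) = (\<integral>\<^sup>+D. (\<integral>\<^sup>+x. f (D(i := x)) \<partial>measure_pmf F) \<partial>config_space F)"
proof -
  define M' where "M' = PiM (UNIV - {i}) (\<lambda>i::int. measure_pmf F)"
  interpret M': prob_space M'
    unfolding M'_def by (intro prob_space_PiM prob_space_measure_pmf)
  interpret C: prob_space "config_space F" by simp
  interpret P: pair_sigma_finite "measure_pmf F" M' ..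
  have eq: "config_space F = distr (measure_pmf F \<Otimes>\<^sub>M M') (config_space F) (\<lambda>(x, X). X(i := x))"
    using distr_pair_PiM_eq_PiM[of "UNIV - {i}" "\<lambda>_. measure_pmf F" i]
    by (simp add: config_space_def M'_def prob_space_measure_pmf insert_absorb)
  have "(\<lambda>z. (snd z)(i := fst z)) \<in> measure_pmf F \<Otimes>\<^sub>M M' \<rightarrow>\<^sub>M config_space F"
    unfolding config_space_def M'_def
    by (rule measurable_fun_upd[where J="UNIV - {i}"]) auto
  then have [measurable]: "(\<lambda>(x, X). X(i := x)) \<in> measure_pmf F \<Otimes>\<^sub>M M' \<rightarrow>\<^sub>M config_space F"
    by (simp add: case_prod_beta)
  have split: "(\<integral>\<^sup>+D. g D \<partial>config_space F) = (\<integral>\<^sup>+x. (\<integral>\<^sup>+X. g (X(i := x)) \<partial>M') \<partial>measure_pmf F)"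
    if [measurable]: "g \<in> borel_measurable (config_space F)" for g
  proof -
    have "(\<integral>\<^sup>+D. g D \<partial>config_space F) = (\<integral>\<^sup>+z. g ((\<lambda>(x, X). X(i := x)) z) \<partial>(measure_pmf F \<Otimes>\<^sub>M M'))"
      by (subst eq, subst nn_integral_distr) auto
    also have "\<dots> = (\<integral>\<^sup>+x. (\<integral>\<^sup>+X. g (X(i := x)) \<partial>M') \<partial>measure_pmf F)"
      by (subst M'.nn_integral_fst[symmetric]) auto
    finally show ?thesis .
  qed
  have "(\<lambda>z. f ((\<lambda>(x, D). D(i := x)) (snd z, fst z))) \<in> borel_measurable (config_space F \<Otimes>\<^sub>M measure_pmf F)"
    by measurable
  then have "(\<lambda>D. \<integral>\<^sup>+x. f (D(i := x)) \<partial>measure_pmf F) \<in> borel_measurable (config_space F)"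
    by (auto dest: measure_pmf.borel_measurable_nn_integral_fst)
  from split[OF this]
  have "(\<integral>\<^sup>+D. (\<integral>\<^sup>+x. f (D(i := x)) \<partial>measure_pmf F) \<partial>config_space F)
      = (\<integral>\<^sup>+y. (\<integral>\<^sup>+X. (\<integral>\<^sup>+x. f (X(i := x)) \<partial>measure_pmf F) \<partial>M') \<partial>measure_pmf F)"
    by simp
  also have "\<dots> = (\<integral>\<^sup>+X. (\<integral>\<^sup>+x. f (X(i := x)) \<partial>measure_pmf F) \<partial>M')"
    by (simp add: measure_pmf.emeasure_space_1)
  also have "\<dots> = (\<integral>\<^sup>+x. (\<integral>\<^sup>+X. f (X(i := x)) \<partial>M') \<partial>measure_pmf F)"
  proof -
    have "(\<lambda>z. f ((\<lambda>(x, X). X(i := x)) z)) \<in> borel_measurable (measure_pmf F \<Otimes>\<^sub>M M')"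
      by measurable
    from P.Fubini'[of "\<lambda>x X. f (X(i := x))"] this show ?thesis
      by (simp add: case_prod_beta')
  qed
  also have "\<dots> = (\<integral>\<^sup>+D. f D \<partial>config_space F)"
    by (rule split[symmetric]) fact
  finally show ?thesis ..
qed

section \<open>Waiting times\<close>

text \<open>Law of the waiting time in the Lindley recursion started at 0; truncated subtraction
  supplies the maximum with 0.\<close>

primrec lindley :: "nat pmf \<Rightarrow> nat \<Rightarrow> nat pmf" where
  "lindley G 0 = return_pmf 0"
| "lindley G (Suc n) = bind_pmf G (\<lambda>x. map_pmf (\<lambda>w. x + w - 1) (lindley G n))"

lemma nn_integral_lindley_Suc:
  "(\<integral>\<^sup>+w. f w \<partial>measure_pmf (lindley G (Suc n)))
     = (\<integral>\<^sup>+x. (\<integral>\<^sup>+w. f (x + w - 1) \<partial>measure_pmf (lindley G n)) \<partial>measure_pmf G)"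
  by (simp add: nn_integral_bind_pmf)

text \<open>The first step cannot go below the starting value 0, and \<open>x + w - 1\<close> is
  monotone in \<open>w\<close>, so the stochastic order is passed on by induction.\<close>

lemma lindley_mono:
  fixes f :: "nat \<Rightarrow> ennreal"
  assumes "mono f"
  shows "(\<integral>\<^sup>+w. f w \<partial>measure_pmf (lindley G n)) \<le> (\<integral>\<^sup>+w. f w \<partial>measure_pmf (lindley G (Suc n)))"
  using assms
proof (induction n arbitrary: f)
  case 0
  have "f 0 = (\<integral>\<^sup>+x. f 0 \<partial>measure_pmf (lindley G (Suc 0)))"
    by (simp add: measure_pmf.emeasure_space_1)
  also have "\<dots> \<le> (\<integral>\<^sup>+x. f x \<partial>measure_pmf (lindley G (Suc 0)))"
    by (intro nn_integral_mono monoD[OF 0]) simp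
  finally show ?case by (simp add: nn_integral_return)
next
  case (Suc n)
  have "mono (\<lambda>w. f (x + w - 1))" for x
    using Suc.prems by (auto simp: mono_def)
  then show ?case
    by (subst (1 2) nn_integral_lindley_Suc) (intro nn_integral_mono Suc.IH)
qed

text \<open>Kingman's bound: compare the second moments of two successive waiting times; they increase,
  so the drift term, which is linear in the mean, is controlled by the second moment of a step.\<close>

lemma nn_integral_lindley_le:
  assumes mean: "(\<integral>\<^sup>+x. of_nat (2 * x) \<partial>measure_pmf G) \<le> 1"
    and sq: "(\<integral>\<^sup>+x. of_nat (x\<^sup>2) \<partial>measure_pmf G) < \<infinity>"
  shows "(\<integral>\<^sup>+w. of_nat w \<partial>measure_pmf (lindley G n)) \<le> (\<integral>\<^sup>+x. of_nat (x\<^sup>2) \<partial>measure_pmf G) + 1"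
proof -
  let ?m = "\<lambda>n. \<integral>\<^sup>+w. (of_nat w :: ennreal) \<partial>measure_pmf (lindley G n)"
  let ?q = "\<lambda>n. \<integral>\<^sup>+w. (of_nat (w\<^sup>2) :: ennreal) \<partial>measure_pmf (lindley G n)"
  let ?s = "(\<integral>\<^sup>+x. of_nat (x\<^sup>2) \<partial>measure_pmf G) + 1 :: ennreal"
  have step: "?q (Suc n) + 2 * ?m n \<le> ?q n + ?m n + ?s" for n
  proof -
    \<comment> \<open>Expansion of \<open>(y - 1)^2\<close> for \<open>y = x + w\<close>. A term
      \<open>2 * x\<close> is dropped, and truncation matters only at \<open>y = 0\<close>.\<close>
    have key: "(x + w - 1)\<^sup>2 + 2 * w \<le> w\<^sup>2 + (2 * x) * w + (x\<^sup>2 + 1)" for x w :: nat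
    proof (cases "x + w")
      case (Suc y)
      then have "(x + w)\<^sup>2 + 1 = (x + w - 1)\<^sup>2 + 2 * w + 2 * x"
        by (simp add: power2_eq_square)
      moreover have "(x + w)\<^sup>2 = w\<^sup>2 + (2 * x) * w + x\<^sup>2"
        by (simp add: power2_sum)
      ultimately show ?thesis by linarith
    qed auto
    have le: "(of_nat ((x + w - 1)\<^sup>2) + 2 * of_nat w :: ennreal)
        \<le> of_nat (w\<^sup>2) + of_nat (2 * x) * of_nat w + (of_nat (x\<^sup>2) + 1)" for x w :: nat
      using of_nat_mono[OF key[of x w], where 'a=ennreal]
      by (simp add: add_ac)
    have "?q (Suc n) + 2 * ?m n
        = (\<integral>\<^sup>+x. (\<integral>\<^sup>+w. of_nat ((x + w - 1)\<^sup>2) \<partial>measure_pmf (lindley G n)) \<partial>measure_pmf G)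
        + (\<integral>\<^sup>+x. (\<integral>\<^sup>+w. 2 * of_nat w \<partial>measure_pmf (lindley G n)) \<partial>measure_pmf G)"
      unfolding nn_integral_lindley_Suc
      by (simp add: measure_pmf.emeasure_space_1 nn_integral_cmult)
    also have "\<dots> = (\<integral>\<^sup>+x. (\<integral>\<^sup>+w. of_nat ((x + w - 1)\<^sup>2) + 2 * of_nat w \<partial>measure_pmf (lindley G n)) \<partial>measure_pmf G)"
      by (simp add: nn_integral_add)
    also have "\<dots> \<le> (\<integral>\<^sup>+x. (\<integral>\<^sup>+w. of_nat (w\<^sup>2) + of_nat (2 * x) * of_nat w + (of_nat (x\<^sup>2) + 1)
                      \<partial>measure_pmf (lindley G n)) \<partial>measure_pmf G)"
      by (intro nn_integral_mono le)
    also have "\<dots> = ?q n + (\<integral>\<^sup>+x. of_nat (2 * x) \<partial>measure_pmf G) * ?m n + ?s"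
      by (simp add: nn_integral_add nn_integral_cmult nn_integral_multc measure_pmf.emeasure_space_1
          del: of_nat_mult of_nat_power)
    \<comment> \<open>By \<open>mean\<close> the cross term costs at most one \<open>?m n\<close>
      against the drift \<open>2 * ?m n\<close>; the other one is what gets bounded.\<close>
    also have "\<dots> \<le> ?q n + 1 * ?m n + ?s"
      by (intro add_mono mult_right_mono mean) auto
    finally show ?thesis by simp
  qed
  have m_le_q: "?m n \<le> ?q n" for n
    by (intro nn_integral_mono of_nat_mono) (simp add: power2_eq_square)
  \<comment> \<open>Finite second moments permit the final cancellation, which is invalid in
    \<open>ennreal\<close> for infinite terms.\<close>
  have fin: "?q n < \<infinity>" for n
  proof (induction n)
    case 0 then show ?case by (simp add: nn_integral_return)
  next
    case (Suc n)
    have "?q (Suc n) \<le> ?q (Suc n) + 2 * ?m n" by simp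
    also have "\<dots> \<le> ?q n + ?m n + ?s" by (rule step)
    also have "\<dots> < \<infinity>" using Suc m_le_q[of n] sq by (auto simp: less_top[symmetric] top_unique)
    finally show ?case .
  qed
  have fm: "?m n < \<infinity>" using fin[of n] m_le_q[of n] by (rule le_less_trans[rotated])
  have q_mono: "?q n \<le> ?q (Suc n)"
    by (intro lindley_mono monoI of_nat_mono power_mono) auto
  have "?q n + 2 * ?m n \<le> ?q n + ?m n + ?s"
    by (rule order_trans[OF add_right_mono[OF q_mono] step])
  then have "(?q n + ?m n) + ?m n \<le> (?q n + ?m n) + ?s"
    by (simp only: mult_2 add.assoc)
  then show "?m n \<le> ?s"
    using fin[of n] fm by (subst (asm) ennreal_add_left_cancel_le) auto
qed

text \<open>\<open>walk h s n i D\<close> is the maximum over \<open>m \<le> n\<close> of the sums of \<open>h (D (i + k s)) - 1\<close> over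
  \<open>k < m\<close>, written as a recursion that peels off the first site.\<close>

primrec walk :: "(nat \<Rightarrow> nat) \<Rightarrow> int \<Rightarrow> nat \<Rightarrow> int \<Rightarrow> config \<Rightarrow> nat" where
  "walk h s 0 i D = 0"
| "walk h s (Suc n) i D = h (D i) + walk h s n (i + s) D - 1"

lemma measurable_walk [measurable]: "walk h s n i \<in> config_space F \<rightarrow>\<^sub>M count_space UNIV"
proof (induction n arbitrary: i)
  case (Suc n)
  have [measurable]: "walk h s n (i + s) \<in> config_space F \<rightarrow>\<^sub>M count_space UNIV" by (rule Suc.IH)
  have "(\<lambda>D. h (D i) + walk h s n (i + s) D - 1) \<in> config_space F \<rightarrow>\<^sub>M count_space UNIV"
    by measurable
  moreover have "walk h s (Suc n) i = (\<lambda>D. h (D i) + walk h s n (i + s) D - 1)" by auto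
  ultimately show ?case by simp
next
  case 0
  have "walk h s 0 i = (\<lambda>_. 0)" by auto
  then show ?case by simp
qed

lemma walk_update: "(\<And>k::nat. j \<noteq> i + int k * s) \<Longrightarrow> walk h s n i (D(j := x)) = walk h s n i D"
proof (induction n arbitrary: i)
  case (Suc n)
  have "j \<noteq> (i + s) + int k * s" for k
    using Suc.prems[of "Suc k"] by (simp add: algebra_simps)
  with Suc.IH Suc.prems[of 0] show ?case by simp
qed simp

lemma walk_shift_update:
  assumes "s \<noteq> 0" shows "walk h s n (i + s) (D(i := x)) = walk h s n (i + s) D"
proof (rule walk_update)
  fix k :: nat
  have "s * (1 + int k) \<noteq> 0" using assms by auto
  then show "i \<noteq> i + s + int k * s" by (simp add: algebra_simps)
qed

text \<open>The tail walk from \<open>i + s\<close> does not read site \<open>i\<close>, so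
  resampling that site produces one step of the Lindley recursion. Keeping \<open>i\<close>
  arbitrary lets the induction move along the line.\<close>

lemma nn_integral_walk:
  assumes "s \<noteq> 0"
  shows "(\<integral>\<^sup>+D. f (walk h s n i D) \<partial>config_space F) = (\<integral>\<^sup>+w. f w \<partial>measure_pmf (lindley (map_pmf h F) n))"
proof (induction n arbitrary: i f)
  case 0
  interpret prob_space "config_space F" by simp
  show ?case by (simp add: emeasure_space_1[simplified] nn_integral_return)
next
  case (Suc n)
  interpret C: prob_space "config_space F" by simp
  interpret Q: pair_sigma_finite "measure_pmf F" "config_space F" ..
  have [measurable]: "(\<lambda>z. walk h s n (i + s) (snd z)) \<in> measure_pmf F \<Otimes>\<^sub>M config_space F \<rightarrow>\<^sub>M count_space UNIV"
    "(\<lambda>z. h (fst z)) \<in> measure_pmf F \<Otimes>\<^sub>M config_space F \<rightarrow>\<^sub>M count_space UNIV"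
    by (rule measurable_compose[OF measurable_snd], simp, rule measurable_compose[OF measurable_fst], simp)
  have m: "(\<lambda>(x, D). f (h x + walk h s n (i + s) D - 1)) \<in> borel_measurable (measure_pmf F \<Otimes>\<^sub>M config_space F)"
    unfolding case_prod_beta by measurable
  have "(\<integral>\<^sup>+D. f (walk h s (Suc n) i D) \<partial>config_space F)
    = (\<integral>\<^sup>+D. (\<integral>\<^sup>+x. f (h x + walk h s n (i + s) D - 1) \<partial>measure_pmf F) \<partial>config_space F)"
    by (subst nn_integral_config_resample[where i=i]) (simp_all add: walk_shift_update assms)
  also have "\<dots> = (\<integral>\<^sup>+x. (\<integral>\<^sup>+D. f (h x + walk h s n (i + s) D - 1) \<partial>config_space F) \<partial>measure_pmf F)"
    by (rule Q.Fubini'[OF m])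
  also have "\<dots> = (\<integral>\<^sup>+x. (\<integral>\<^sup>+w. f (h x + w - 1) \<partial>measure_pmf (lindley (map_pmf h F) n)) \<partial>measure_pmf F)"
    by (subst Suc.IH) rule
  finally show ?case
    by (subst nn_integral_lindley_Suc) simp
qed

lemma walk_mono: "walk h s n i D \<le> walk h s (Suc n) i D"
proof (induction n arbitrary: i)
  case (Suc n)
  have "walk h s (Suc n) i D = h (D i) + walk h s n (i + s) D - 1" by simp
  also have "\<dots> \<le> h (D i) + walk h s (Suc n) (i + s) D - 1"
    by (intro diff_le_mono add_left_mono Suc.IH)
  finally show ?case by simp
qed simp

text \<open>Truncation at 0 only increases the walk, so adding back the \<open>n\<close> unit
  decrements dominates the plain sum.\<close>

lemma sum_le_walk: "(\<Sum>k<n. h (D (i + int k * s))) \<le> n + walk h s n i D"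
proof (induction n arbitrary: i)
  case (Suc n)
  have "(\<Sum>k<Suc n. h (D (i + int k * s))) = h (D i) + (\<Sum>k<n. h (D ((i + s) + int k * s)))"
    by (subst sum.lessThan_Suc_shift) (simp add: algebra_simps)
  also have "\<dots> \<le> h (D i) + (n + walk h s n (i + s) D)"
    by (intro add_left_mono Suc.IH)
  finally show ?case by simp
qed simp

text \<open>The walk starts at \<open>s\<close> and not at the origin, so for nonzero
  \<open>s\<close> it never reads \<open>D 0\<close>; this gives independence from the degree of the
  origin.\<close>

definition overshoot :: "(nat \<Rightarrow> nat) \<Rightarrow> int \<Rightarrow> config \<Rightarrow> ennreal" where
  "overshoot h s D = (SUP n. of_nat (walk h s n s D))"

lemma measurable_overshoot [measurable]: "overshoot h s \<in> borel_measurable (config_space F)"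
  unfolding overshoot_def[abs_def] by measurable

lemma sum_le_overshoot: "of_nat (\<Sum>k<n. h (D (s + int k * s))) \<le> of_nat n + overshoot h s D"
proof -
  have "(of_nat (\<Sum>k<n. h (D (s + int k * s))) :: ennreal) \<le> of_nat (n + walk h s n s D)"
    by (intro of_nat_mono sum_le_walk)
  also have "\<dots> \<le> of_nat n + overshoot h s D"
    unfolding overshoot_def of_nat_add by (intro add_left_mono SUP_upper) simp
  finally show ?thesis .
qed

lemma overshoot_update:
  assumes "s \<noteq> 0" shows "overshoot h s (D(0 := x)) = overshoot h s D"
  using walk_shift_update[OF assms, of h _ 0] by (simp add: overshoot_def)

text \<open>The walks increase in \<open>n\<close>, so monotone convergence carries the bound on the
  waiting times, uniform in \<open>n\<close>, to the supremum.\<close>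

lemma nn_integral_overshoot_less_top:
  assumes "s \<noteq> 0"
    and mean: "(\<integral>\<^sup>+x. of_nat (2 * h x) \<partial>measure_pmf F) \<le> 1"
    and sq: "(\<integral>\<^sup>+x. of_nat ((h x)\<^sup>2) \<partial>measure_pmf F) < \<infinity>"
  shows "(\<integral>\<^sup>+D. overshoot h s D \<partial>config_space F) < \<infinity>"
proof -
  have "(\<integral>\<^sup>+D. overshoot h s D \<partial>config_space F) = (SUP n. \<integral>\<^sup>+D. of_nat (walk h s n s D) \<partial>config_space F)"
    unfolding overshoot_def
    by (intro nn_integral_monotone_convergence_SUP)
       (auto simp: mono_iff_le_Suc le_fun_def intro!: of_nat_mono walk_mono simp del: walk.simps)
  also have "\<dots> = (SUP n. \<integral>\<^sup>+w. of_nat w \<partial>measure_pmf (lindley (map_pmf h F) n))"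
    by (subst nn_integral_walk[OF assms(1)]) rule
  also have "\<dots> \<le> (\<integral>\<^sup>+x. of_nat (x\<^sup>2) \<partial>measure_pmf (map_pmf h F)) + 1"
    by (intro SUP_least nn_integral_lindley_le) (use mean sq in simp_all)
  also have "\<dots> < \<infinity>" using sq by (simp add: less_top[symmetric])
  finally show ?thesis .
qed

section \<open>Claimed vertices are sparse\<close>

text \<open>Keep a window of maximal radius \<open>r x\<close>. A window meeting it has its centre
  within \<open>2 * r x\<close> of \<open>x\<close>, which leaves at most \<open>4 * r x + 1\<close>
  centres; the windows disjoint from it are treated by induction.\<close>

lemma vitali_int:
  fixes r :: "int \<Rightarrow> nat"
  assumes "finite Q"
  shows "\<exists>S\<subseteq>Q. disjoint_family_on (\<lambda>x. {x - int (r x)..x + int (r x)}) S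
           \<and> card Q \<le> (\<Sum>x\<in>S. 4 * r x + 1)"
  using assms
proof (induction Q rule: finite_psubset_induct)
  case (psubset Q)
  let ?W = "\<lambda>x. {x - int (r x)..x + int (r x)}"
  show ?case
  proof (cases "Q = {}")
    case True
    then show ?thesis by (auto simp: disjoint_family_on_def)
  next
    case False
    then have "Max (r ` Q) \<in> r ` Q" using psubset.hyps by (intro Max_in) auto
    then obtain x where x: "x \<in> Q" "r x = Max (r ` Q)" by fastforce
    have r_le: "r y \<le> r x" if "y \<in> Q" for y
      unfolding x(2) using psubset.hyps that by (intro Max_ge) auto
    define Q' where "Q' = {y\<in>Q. ?W y \<inter> ?W x = {}}"
    have "x \<notin> Q'" "Q' \<subseteq> Q" by (auto simp: Q'_def)
    then have "Q' \<subset> Q" using x by auto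
    from psubset.IH[OF this] obtain S where S: "S \<subseteq> Q'" "disjoint_family_on ?W S"
      "card Q' \<le> (\<Sum>x\<in>S. 4 * r x + 1)" by auto
    have finS: "finite S" "x \<notin> S"
      using S(1) psubset.hyps \<open>x \<notin> Q'\<close> \<open>Q' \<subseteq> Q\<close> by (meson finite_subset, blast)
    have "Q - Q' \<subseteq> {x - 2 * int (r x)..x + 2 * int (r x)}"
    proof
      fix y assume y: "y \<in> Q - Q'"
      then have "?W y \<inter> ?W x \<noteq> {}" unfolding Q'_def by blast
      then obtain z where "z \<in> ?W y" "z \<in> ?W x" by blast
      moreover have "r y \<le> r x" using r_le y by auto
      ultimately show "y \<in> {x - 2 * int (r x)..x + 2 * int (r x)}" by auto
    qed
    then have "card (Q - Q') \<le> 4 * r x + 1"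
      using card_mono[of "{x - 2 * int (r x)..x + 2 * int (r x)}" "Q - Q'"] by simp
    moreover have "card Q = card Q' + card (Q - Q')"
      using psubset.hyps \<open>Q' \<subseteq> Q\<close> finite_subset[OF \<open>Q' \<subseteq> Q\<close>]
      by (subst card_Un_disjoint[symmetric]) (auto intro!: arg_cong[where f=card])
    ultimately have "card Q \<le> (\<Sum>x\<in>insert x S. 4 * r x + 1)"
      using S(3) finS by simp
    moreover have "disjoint_family_on ?W (insert x S)"
    proof -
      have "?W x \<inter> (\<Union>y\<in>S. ?W y) = {}" using S(1) unfolding Q'_def by blast
      then show ?thesis using S(2) disjoint_family_on_insert[OF finS(2), of ?W] by blast
    qed
    moreover have "insert x S \<subseteq> Q" using S(1) x \<open>Q' \<subseteq> Q\<close> by blast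
    ultimately show ?thesis by blast
  qed
qed

lemma sum_symmetric_interval:
  fixes f :: "int \<Rightarrow> 'a::comm_monoid_add"
  shows "(\<Sum>k\<in>{-int n..int n}. f k) = f 0 + ((\<Sum>k<n. f (1 + int k * 1)) + (\<Sum>k<n. f (-1 + int k * -1)))"
proof (induction n)
  case (Suc n)
  have "{-int (Suc n)..int (Suc n)} = insert (-1 - int n) (insert (1 + int n) {-int n..int n})"
    by auto
  then show ?case by (simp add: Suc.IH add_ac)
qed simp

text \<open>The factor 40 makes the covering argument below (which loses a factor 5 from overlaps and has
  windows protruding on both sides) leave at least a quarter of the sites on each side unclaimed.\<close>

abbreviation load :: "nat \<Rightarrow> nat \<Rightarrow> nat" where
  "load d x \<equiv> 40 * (x - d)"

text \<open>A claimed vertex has a window with at least as many bad stubs as its radius. Disjoint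
  windows of total radius \<open>s\<close> hold at least \<open>s\<close> bad stubs,
  \<open>5 * s\<close> bounds the number of claimed vertices, and the walks bound the bad stubs
  available.\<close>

lemma card_claimed_le:
  fixes D :: config
  shows "\<exists>n. 4 * card {x\<in>{-int N..int N}. claimed d D x}
    \<le> 2 * N + load d (D 0) + walk (load d) 1 n 1 D + walk (load d) (-1) n (-1) D"
proof -
  let ?Q = "{x\<in>{-int N..int N}. claimed d D x}"
  let ?X = "trunc d D"
  have "\<forall>x\<in>?Q. \<exists>m\<ge>1. (\<Sum>k\<in>{x - int m..x + int m}. ?X k) \<ge> m"
    by (auto simp: claimed_def)
  then obtain r where r: "\<And>x. x \<in> ?Q \<Longrightarrow> r x \<ge> (1::nat)"
    "\<And>x. x \<in> ?Q \<Longrightarrow> (\<Sum>k\<in>{x - int (r x)..x + int (r x)}. ?X k) \<ge> r x"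
    by metis
  let ?W = "\<lambda>x. {x - int (r x)..x + int (r x)}"
  have finQ: "finite ?Q" by (rule finite_subset[of _ "{-int N..int N}"]) auto
  from vitali_int[OF finQ, of r] obtain S where S: "S \<subseteq> ?Q" "disjoint_family_on ?W S"
    "card ?Q \<le> (\<Sum>x\<in>S. 4 * r x + 1)" by auto
  have finS: "finite S" using S(1) finQ by (rule finite_subset)
  define s where "s = (\<Sum>x\<in>S. r x)"
  have "card ?Q \<le> (\<Sum>x\<in>S. 5 * r x)"
    using S r by (intro order_trans[OF S(3)] sum_mono) fastforce
  then have card: "card ?Q \<le> 5 * s" by (simp add: s_def sum_distrib_left)
  have "s \<le> (\<Sum>x\<in>S. \<Sum>k\<in>?W x. ?X k)"
    unfolding s_def using S(1) r by (intro sum_mono) auto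
  also have "\<dots> = (\<Sum>k\<in>(\<Union>x\<in>S. ?W x). ?X k)"
    using S(2) finS by (subst sum.UNION_disjoint) (auto simp: disjoint_family_on_def)
  also have "\<dots> \<le> (\<Sum>k\<in>{-int (N + s)..int (N + s)}. ?X k)"
  proof (rule sum_mono2)
    \<comment> \<open>A window centred in \<open>[-N, N]\<close> protrudes by at most its radius,
      hence by at most \<open>s\<close>.\<close>
    show "(\<Union>x\<in>S. ?W x) \<subseteq> {-int (N + s)..int (N + s)}"
    proof (rule UN_least)
      fix x assume "x \<in> S"
      then have "r x \<le> s" "x \<in> ?Q" using finS S(1) by (auto simp: s_def intro: member_le_sum)
      then show "?W x \<subseteq> {-int (N + s)..int (N + s)}" by auto
    qed
  qed auto
  also have "\<dots> = ?X 0 + ((\<Sum>k<N+s. ?X (1 + int k * 1)) + (\<Sum>k<N+s. ?X (-1 + int k * -1)))"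
    by (rule sum_symmetric_interval)
  finally have "40 * s \<le> load d (D 0) + (\<Sum>k<N+s. load d (D (1 + int k * 1)))
      + (\<Sum>k<N+s. load d (D (-1 + int k * -1)))"
    by (simp add: trunc_def sum_distrib_left[symmetric])
  also have "\<dots> \<le> load d (D 0) + (N + s + walk (load d) 1 (N+s) 1 D)
      + (N + s + walk (load d) (-1) (N+s) (-1) D)"
    by (intro add_mono sum_le_walk order_refl)
  \<comment> \<open>Moving the \<open>2 * s\<close> of the two walk bounds to the left leaves
    \<open>38 * s\<close>, enough for the \<open>20 * s\<close> that dominates four times the
    count.\<close>
  finally show ?thesis
    using card by (intro exI[of _ "N + s"]) linarith
qed

text \<open>Random length scale for the cluster of the origin, split into a part read off
  \<open>D 0\<close> and a part that ignores it.\<close>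

definition spread :: "nat \<Rightarrow> config \<Rightarrow> ennreal" where
  "spread d D = of_nat (load d (D 0)) + (overshoot (load d) 1 D + overshoot (load d) (-1) D)"

lemma measurable_spread [measurable]: "spread d \<in> borel_measurable (config_space F)"
  unfolding spread_def[abs_def] by measurable

lemma card_claimed_le_spread:
  "of_nat (4 * card {x\<in>{-int N..int N}. claimed d D x}) \<le> of_nat (2 * N) + spread d D"
proof -
  obtain n where "4 * card {x\<in>{-int N..int N}. claimed d D x}
    \<le> 2 * N + load d (D 0) + walk (load d) 1 n 1 D + walk (load d) (-1) n (-1) D"
    using card_claimed_le by blast
  then have "(of_nat (4 * card {x\<in>{-int N..int N}. claimed d D x}) :: ennreal)
    \<le> of_nat (2 * N + load d (D 0) + walk (load d) 1 n 1 D + walk (load d) (-1) n (-1) D)"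
    by (rule of_nat_mono)
  also have "\<dots> = of_nat (2 * N) + (of_nat (load d (D 0)) +
      (of_nat (walk (load d) 1 n 1 D) + of_nat (walk (load d) (-1) n (-1) D)))"
    by (simp only: of_nat_add add.assoc)
  also have "\<dots> \<le> of_nat (2 * N) + spread d D"
    unfolding spread_def overshoot_def by (intro add_mono SUP_upper order_refl) auto
  finally show ?thesis .
qed

text \<open>At most three quarters of \<open>N\<close> vertices of \<open>[-N, N]\<close> are
  claimed. Even if all of them lie in \<open>J\<close>, a quarter of \<open>J\<close>
  remains.\<close>

lemma card_unclaimed_ge:
  assumes J: "J \<subseteq> {-int N..int N}" "card J = N" and le: "spread d D \<le> of_nat N"
  shows "N \<le> 4 * card ({x. \<not> claimed d D x} \<inter> J)"
proof -
  have fin: "finite J" using J(1) finite_subset by blast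
  have "(of_nat (4 * card {x\<in>{-int N..int N}. claimed d D x}) :: ennreal) \<le> of_nat (2 * N) + of_nat N"
    by (intro order_trans[OF card_claimed_le_spread] add_left_mono le)
  also have "\<dots> = of_nat (3 * N)" by (simp only: of_nat_add[symmetric]) simp
  finally have c: "4 * card {x\<in>{-int N..int N}. claimed d D x} \<le> 3 * N"
    by (simp only: of_nat_le_iff)
  have "N = card ({x. \<not> claimed d D x} \<inter> J) + card ({x. claimed d D x} \<inter> J)"
    unfolding J(2)[symmetric] using fin
    by (subst card_Un_disjoint[symmetric]) (auto intro!: arg_cong[where f=card])
  moreover have "card ({x. claimed d D x} \<inter> J) \<le> card {x\<in>{-int N..int N}. claimed d D x}"
    using J(1) by (intro card_mono[OF finite_subset[of _ "{-int N..int N}"]]) auto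
  ultimately show ?thesis using c by linarith
qed

section \<open>Finiteness and size of clusters\<close>

definition seg :: "bool \<Rightarrow> nat \<Rightarrow> int set" where
  "seg b N = (if b then {1..int N} else {-int N..-1})"

lemma seg_props: "finite (seg b N)" "card (seg b N) = N" "seg b N \<subseteq> {-int N..int N}"
  by (auto simp: seg_def)

lemma clust_subset:
  assumes "\<not> claimed d D x" "\<not> claimed d D y" "y < i" "i < x"
  shows "clust d D i \<subseteq> {y<..<x}"
proof
  fix k assume "k \<in> clust d D i"
  then have *: "l \<in> {min i k..max i k} \<Longrightarrow> claimed d D l" for l by (auto simp: clust_def)
  have "x \<notin> {min i k..max i k}" "y \<notin> {min i k..max i k}" using *[of x] *[of y] assms by blast+
  with assms show "k \<in> {y<..<x}" by auto
qed

text \<open>Pigeonhole: on each side more than \<open>|i|\<close> vertices of the segment are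
  unclaimed, so one of them is farther from the origin than \<open>|i|\<close>.\<close>

lemma unclaimed_beyond:
  assumes "spread d D \<le> of_nat N" "4 * nat \<bar>i\<bar> < N"
  shows "\<exists>x\<in>{1..int N}. \<not> claimed d D x \<and> \<bar>i\<bar> < x" "\<exists>y\<in>{-int N..-1}. \<not> claimed d D y \<and> y < -\<bar>i\<bar>"
proof -
  have *: "\<exists>x\<in>seg b N. \<not> claimed d D x \<and> x \<notin> seg b (nat \<bar>i\<bar>)" for b
  proof (rule ccontr)
    assume "\<not> ?thesis"
    then have "card ({x. \<not> claimed d D x} \<inter> seg b N) \<le> card (seg b (nat \<bar>i\<bar>))"
      by (intro card_mono) (auto simp: seg_props)
    moreover have "N \<le> 4 * card ({x. \<not> claimed d D x} \<inter> seg b N)"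
      by (intro card_unclaimed_ge assms seg_props)
    ultimately show False using assms(2) by (simp add: seg_props)
  qed
  from *[of True] show "\<exists>x\<in>{1..int N}. \<not> claimed d D x \<and> \<bar>i\<bar> < x" by (auto simp: seg_def)
  from *[of False] show "\<exists>y\<in>{-int N..-1}. \<not> claimed d D y \<and> y < -\<bar>i\<bar>" by (auto simp: seg_def)
qed

lemma ennreal_nat_upper:
  assumes "(x::ennreal) < \<infinity>"
  obtains N where "x \<le> of_nat N" "of_nat N \<le> x + 1"
proof -
  from assms obtain r where r: "x = ennreal r" "r \<ge> 0" by (cases x) auto
  define N where "N = nat \<lceil>r\<rceil>"
  have "r \<le> real N" "real N \<le> r + 1" using r(2) unfolding N_def by linarith+
  then have "x \<le> of_nat N" "of_nat N \<le> x + 1"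
    using r(2) by (auto simp: r(1) ennreal_of_nat_eq_real_of_nat ennreal_plus[symmetric] simp del: ennreal_plus
        intro!: ennreal_leI simp flip: ennreal_1)
  then show ?thesis by (rule that)
qed

lemma finite_clust:
  assumes "spread d D < \<infinity>"
  shows "finite (clust d D i)"
proof -
  obtain N0 where "spread d D \<le> of_nat N0" using ennreal_nat_upper[OF assms] .
  then have N: "spread d D \<le> of_nat (N0 + 4 * nat \<bar>i\<bar> + 1)"
    by (rule order_trans) (intro of_nat_mono, simp)
  from unclaimed_beyond[OF N, of i] obtain x y where
    "\<not> claimed d D x" "\<bar>i\<bar> < x" "\<not> claimed d D y" "y < -\<bar>i\<bar>" by auto
  then have "clust d D i \<subseteq> {y<..<x}" by (intro clust_subset) auto
  then show ?thesis by (rule finite_subset) simp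
qed

lemma clust_0_subset:
  assumes "spread d D \<le> of_nat m" "m > 0"
  shows "clust d D 0 \<subseteq> {-int m..int m}"
proof -
  from unclaimed_beyond[OF assms(1), of 0] assms(2) obtain x y where
    "\<not> claimed d D x" "0 < x" "x \<le> int m" "\<not> claimed d D y" "y < 0" "-int m \<le> y" by auto
  then show ?thesis using clust_subset[of d D x y 0] by force
qed

text \<open>Step-1 outcomes are stored at the left endpoint of a cluster, so a cluster must look the
  same from each of its vertices.\<close>

lemma clust_eqI:
  assumes "k \<in> clust d D i" shows "clust d D k = clust d D i"
proof -
  have sub: "clust d D i \<subseteq> clust d D k" if "k \<in> clust d D i" for i k
  proof
    fix l assume l: "l \<in> clust d D i"
    show "l \<in> clust d D k" unfolding clust_def
    proof (intro CollectI ballI)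
      fix x assume "x \<in> {min k l..max k l}"
      then have "x \<in> {min i k..max i k} \<or> x \<in> {min i l..max i l}"
        by (auto simp: min_def max_def split: if_splits)
      then show "claimed d D x" using l that unfolding clust_def by blast
    qed
  qed
  have "i \<in> clust d D k" using assms by (simp add: clust_def min.commute max.commute)
  then show ?thesis by (intro equalityI sub assms)
qed

section \<open>Thinning\<close>

text \<open>A degree in \<open>A\<close> is penalised by 1/2. For the \<open>\<rho>\<close> used
  below, which is the mean penalty under \<open>F\<close>, the weight has mean one.\<close>

definition thin_weight :: "nat set \<Rightarrow> real \<Rightarrow> nat \<Rightarrow> ennreal" where
  "thin_weight A \<rho> n = ennreal ((if n \<in> A then 1/2 else 1) / \<rho>)"

text \<open>As \<open>A\<close> is contained in \<open>B\<close>, the penalty is at least as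
  frequent on \<open>B\<close> as overall; the claim reduces to
  \<open>P(A) * P(B) \<le> P(A)\<close>.\<close>

lemma nn_integral_thin_weight_le:
  fixes F :: "nat pmf" and A B :: "nat set"
  defines "\<rho> \<equiv> 1 - measure_pmf.prob F A / 2"
  assumes "A \<subseteq> B"
  shows "(\<integral>\<^sup>+x. thin_weight A \<rho> x * indicator B x \<partial>measure_pmf F) \<le> emeasure (measure_pmf F) B"
proof -
  have \<rho>: "\<rho> > 0" unfolding \<rho>_def using measure_pmf.prob_le_1[of F A] by linarith
  have "(\<integral>\<^sup>+x. thin_weight A \<rho> x * indicator B x \<partial>measure_pmf F)
      = (\<integral>\<^sup>+x. ennreal ((indicator B x - indicator A x / 2) / \<rho>) \<partial>measure_pmf F)"
    using assms(2) by (intro nn_integral_cong) (auto simp: thin_weight_def indicator_def)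
  also have "\<dots> = ennreal (\<integral>x. (indicator B x - indicator A x / 2) / \<rho> \<partial>measure_pmf F)"
    using assms(2) \<rho> by (intro nn_integral_eq_integral) 
        (auto simp: indicator_def field_simps intro!: AE_I2 measure_pmf.integrable_const_bound[where B="1/\<rho>"])
  also have "(\<integral>x. (indicator B x - indicator A x / 2) / \<rho> \<partial>measure_pmf F)
      = (measure_pmf.prob F B - measure_pmf.prob F A / 2) / \<rho>"
  proof -
    have "integrable (measure_pmf F) (\<lambda>x. indicator X x :: real)" for X
      by (intro measure_pmf.integrable_const_bound[where B=1]) (auto simp: indicator_def)
    then show ?thesis by (simp add: Bochner_Integration.integral_diff)
  qed
  also have "\<dots> \<le> measure_pmf.prob F B"
  proof -
    have "measure_pmf.prob F A * measure_pmf.prob F B \<le> measure_pmf.prob F A"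
      by (intro mult_left_le) auto
    then show ?thesis using \<rho> by (simp add: pos_divide_le_eq) (simp add: \<rho>_def algebra_simps)
  qed
  finally show ?thesis by (simp add: measure_pmf.emeasure_eq_measure ennreal_leI)
qed

text \<open>If membership of a site in \<open>U\<close> does not look at its degree beyond the information that it
  lies in \<open>B\<close>, then given \<open>U\<close> the degrees on \<open>U\<close> are still independent, conditioned to lie in
  \<open>B\<close>. Resampling one site at a time turns this into a supermartingale.\<close>

locale thinning =
  fixes F :: "nat pmf" and A B :: "nat set" and U :: "config \<Rightarrow> int set"
  assumes AB: "A \<subseteq> B"
    and measurable_U: "\<And>i. Measurable.pred (config_space F) (\<lambda>D. i \<in> U D)"
    and U_B: "\<And>D i. i \<in> U D \<Longrightarrow> D i \<in> B"
    and U_update: "\<And>D i x. D i \<in> B \<Longrightarrow> x \<in> B \<Longrightarrow> U (D(i := x)) = U D"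
begin

definition \<rho> :: real where "\<rho> = 1 - measure_pmf.prob F A / 2"

lemma \<rho>_bounds: "0 < \<rho>" "\<rho> \<le> 1"
  unfolding \<rho>_def using measure_pmf.prob_le_1[of F A] measure_nonneg[of F A] by linarith+

lemmas measurable_U' [measurable] = measurable_U

text \<open>Resample the added site \<open>i\<close>. A degree outside \<open>B\<close> keeps
  \<open>i\<close> out of \<open>U\<close>, and its factor is 1. Within \<open>B\<close> the set
  \<open>U\<close> stays fixed, so the other factors are constant and the factor of \<open>i\<close>
  integrates to at most the mass of \<open>B\<close>.\<close>

lemma nn_integral_weight_le:
  assumes "finite J"
  shows "(\<integral>\<^sup>+D. (\<Prod>i\<in>J. if i \<in> U D then thin_weight A \<rho> (D i) else 1) \<partial>config_space F) \<le> 1"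
  using assms
proof (induction J)
  case empty
  interpret prob_space "config_space F" by simp
  show ?case using emeasure_space_1 by simp
next
  case (insert i J)
  define g where "g J D = (\<Prod>i\<in>J. if i \<in> U D then thin_weight A \<rho> (D i) else 1)" for J D
  have [measurable]: "g J \<in> borel_measurable (config_space F)" for J
    unfolding g_def[abs_def] by measurable
  have "(\<integral>\<^sup>+x. g (insert i J) (D(i := x)) \<partial>measure_pmf F) \<le> (\<integral>\<^sup>+x. g J (D(i := x)) \<partial>measure_pmf F)" for D
  proof (cases "\<exists>b\<in>B. i \<in> U (D(i := b))")
    case False
    then have "i \<notin> U (D(i := x))" for x using U_B[of i "D(i := x)"] by auto
    then show ?thesis using insert.hyps by (simp add: g_def)
  next
    case True
    then obtain b where b: "b \<in> B" "i \<in> U (D(i := b))" by blast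
    have UB: "U (D(i := x)) = U (D(i := b))" if "x \<in> B" for x
      using U_update[of "D(i := b)" i x] b(1) that by simp
    define c where "c = (\<Prod>k\<in>J. if k \<in> U (D(i := b)) then thin_weight A \<rho> (D k) else 1)"
    have gB: "g J (D(i := x)) = c" if "x \<in> B" for x
      unfolding g_def c_def UB[OF that] using insert.hyps by (intro prod.cong) auto
    have gc: "g (insert i J) (D(i := x)) =
        c * (thin_weight A \<rho> x * indicator B x) + g J (D(i := x)) * indicator (-B) x" for x
    proof (cases "x \<in> B")
      case True
      then show ?thesis using insert.hyps b(2) UB[OF True] gB[OF True]
        by (simp add: g_def mult.commute)
    next
      case False
      then have "i \<notin> U (D(i := x))" using U_B[of i "D(i := x)"] by auto
      then show ?thesis using insert.hyps False by (simp add: g_def)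
    qed
    have "(\<integral>\<^sup>+x. g (insert i J) (D(i := x)) \<partial>measure_pmf F)
      = c * (\<integral>\<^sup>+x. thin_weight A \<rho> x * indicator B x \<partial>measure_pmf F)
        + (\<integral>\<^sup>+x. g J (D(i := x)) * indicator (-B) x \<partial>measure_pmf F)"
      unfolding gc by (subst nn_integral_add) (auto simp: nn_integral_cmult)
    also have "\<dots> \<le> c * emeasure (measure_pmf F) B
        + (\<integral>\<^sup>+x. g J (D(i := x)) * indicator (-B) x \<partial>measure_pmf F)"
      unfolding \<rho>_def by (intro add_right_mono mult_left_mono nn_integral_thin_weight_le AB) auto
    also have "\<dots> = (\<integral>\<^sup>+x. c * indicator B x \<partial>measure_pmf F)
        + (\<integral>\<^sup>+x. g J (D(i := x)) * indicator (-B) x \<partial>measure_pmf F)"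
      by (simp add: nn_integral_cmult)
    also have "\<dots> = (\<integral>\<^sup>+x. c * indicator B x + g J (D(i := x)) * indicator (-B) x \<partial>measure_pmf F)"
      by (subst nn_integral_add) auto
    also have "\<dots> = (\<integral>\<^sup>+x. g J (D(i := x)) \<partial>measure_pmf F)"
      using gB by (intro nn_integral_cong) (auto simp: indicator_def)
    finally show ?thesis .
  qed
  then have "(\<integral>\<^sup>+D. g (insert i J) D \<partial>config_space F) \<le> (\<integral>\<^sup>+D. g J D \<partial>config_space F)"
    by (subst (1 2) nn_integral_config_resample[where i=i]) (simp_all add: nn_integral_mono)
  also have "\<dots> \<le> 1" using insert.IH by (simp add: g_def)
  finally show ?case by (simp add: g_def)
qed

text \<open>The exceptional event of the thinning argument: the second condition supplies the many
  trials that make the first one unlikely.\<close>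

definition few :: "nat \<Rightarrow> int set \<Rightarrow> config set" where
  "few k J = {D. card {i\<in>J. i \<in> U D \<and> D i \<in> A} < k \<and> card J \<le> 4 * card {i\<in>J. i \<in> U D}}"

text \<open>Exponential Markov inequality: on \<open>few k J\<close> the product of weights is at
  least \<open>2^(-k) * \<rho>^(-card J / 4)\<close>, while its mean is at most one.\<close>

lemma emeasure_few_le:
  assumes "finite J"
  shows "few k J \<in> sets (config_space F)"
    and "emeasure (config_space F) (few k J) \<le> ennreal (2 ^ k * (\<rho> powr (1/4)) ^ card J)"
proof -
  have card_eq: "card {i\<in>J. P i} = (\<Sum>i\<in>J. if P i then 1 else 0)" for P
    using assms by (simp add: sum.If_cases Int_def)
  have "Measurable.pred (config_space F) (\<lambda>D. card {i\<in>J. i \<in> U D \<and> D i \<in> A} < k \<and> card J \<le> 4 * card {i\<in>J. i \<in> U D})"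
    unfolding card_eq by measurable
  then show m: "few k J \<in> sets (config_space F)"
    by (simp add: few_def pred_def)
  \<comment> \<open>The fourth root turns \<open>card J \<le> 4 * card ?V\<close> into a comparison
    of natural powers.\<close>
  let ?s = "\<rho> powr (1/4)"
  have s: "0 < ?s" "?s \<le> 1" "?s ^ 4 = \<rho>"
    using \<rho>_bounds powr_mono2[of "1/4" \<rho> 1] by (auto simp: powr_power)
  let ?g = "\<lambda>D. \<Prod>i\<in>J. if i \<in> U D then thin_weight A \<rho> (D i) else 1"
  have ge: "indicator (few k J) D \<le> ennreal (2 ^ k * ?s ^ card J) * ?g D" for D
  proof (cases "D \<in> few k J")
    case True
    let ?V = "{i\<in>J. i \<in> U D}" and ?VA = "{i\<in>J. i \<in> U D \<and> D i \<in> A}"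
    have "?g D = (\<Prod>i\<in>?V. thin_weight A \<rho> (D i))"
      using assms by (simp add: prod.inter_filter)
    also have "\<dots> = ennreal (\<Prod>i\<in>?V. (if D i \<in> A then 1/2 else 1) / \<rho>)"
      unfolding thin_weight_def using \<rho>_bounds by (subst prod_ennreal) auto
    also have "(\<Prod>i\<in>?V. (if D i \<in> A then 1/2 else 1) / \<rho>) = (1/2) ^ card ?VA / \<rho> ^ card ?V"
    proof -
      have "(\<Prod>i\<in>?V. (if D i \<in> A then 1/2 else (1::real))) = (\<Prod>i\<in>{i\<in>?V. D i \<in> A}. 1/2)"
        using assms by (intro prod.inter_filter[symmetric]) auto
      also have "{i\<in>?V. D i \<in> A} = ?VA" by auto
      finally show ?thesis by (simp add: prod_dividef)
    qed
    finally have g: "?g D = ennreal ((1/2) ^ card ?VA / \<rho> ^ card ?V)" .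
    have "\<rho> ^ card ?V = ?s ^ (4 * card ?V)" by (simp add: power_mult s(3))
    also have "\<dots> \<le> ?s ^ card J"
      using True s by (intro power_decreasing) (auto simp: few_def)
    finally have a: "\<rho> ^ card ?V \<le> ?s ^ card J" .
    have "(1/2::real) ^ k \<le> (1/2) ^ card ?VA"
      using True by (intro power_decreasing) (auto simp: few_def)
    then have b: "1 \<le> 2 ^ k * (1/2::real) ^ card ?VA"
      by (simp add: field_simps power_divide)
    have "1 * 1 \<le> (2 ^ k * (1/2) ^ card ?VA) * (?s ^ card J / \<rho> ^ card ?V)"
      using a b \<rho>_bounds by (intro mult_mono) (auto simp: pos_le_divide_eq)
    then have "1 \<le> 2 ^ k * ?s ^ card J * ((1/2) ^ card ?VA / \<rho> ^ card ?V)" by (simp add: mult_ac)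
    then have "ennreal 1 \<le> ennreal (2 ^ k * ?s ^ card J) * ennreal ((1/2) ^ card ?VA / \<rho> ^ card ?V)"
      using s by (subst ennreal_mult'[symmetric]) (auto intro!: ennreal_leI)
    then show ?thesis using True g by simp
  qed simp
  have "emeasure (config_space F) (few k J) = (\<integral>\<^sup>+D. indicator (few k J) D \<partial>config_space F)"
    using m by simp
  also have "\<dots> \<le> (\<integral>\<^sup>+D. ennreal (2 ^ k * ?s ^ card J) * ?g D \<partial>config_space F)"
    by (intro nn_integral_mono ge)
  also have "\<dots> = ennreal (2 ^ k * ?s ^ card J) * (\<integral>\<^sup>+D. ?g D \<partial>config_space F)"
    by (rule nn_integral_cmult) measurable
  also have "\<dots> \<le> ennreal (2 ^ k * ?s ^ card J) * 1"
    by (intro mult_left_mono nn_integral_weight_le assms) auto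
  finally show "emeasure (config_space F) (few k J) \<le> ennreal (2 ^ k * ?s ^ card J)" by simp
qed

text \<open>For \<open>A\<close> of positive probability the base \<open>\<rho> powr (1/4)\<close>
  is below 1, so even the linearly weighted geometric series converges. The weight
  \<open>Suc N\<close> will be the length of a step-2 edge.\<close>

lemma suminf_few_less_top:
  assumes "measure_pmf.prob F A > 0" and J: "\<And>N. finite (J N)" "\<And>N. card (J N) = N"
  shows "(\<Sum>N. of_nat (Suc N) * emeasure (config_space F) (few k (J N))) < \<infinity>"
proof -
  let ?s = "\<rho> powr (1/4)"
  have s: "0 \<le> ?s" "?s < 1"
    using assms(1) \<rho>_bounds powr_less_mono2[of "1/4" \<rho> 1] by (auto simp: \<rho>_def)
  have "summable (\<lambda>N. of_nat (Suc N) * ?s ^ N)"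
    using geometric_deriv_sums[of ?s] s by (auto simp: sums_iff)
  then have sm: "summable (\<lambda>N. 2 ^ k * (of_nat (Suc N) * ?s ^ N))" by (rule summable_mult)
  have "(\<Sum>N. of_nat (Suc N) * emeasure (config_space F) (few k (J N)))
      \<le> (\<Sum>N. ennreal (2 ^ k * (of_nat (Suc N) * ?s ^ N)))"
  proof (rule suminf_le)
    fix N
    have "of_nat (Suc N) * emeasure (config_space F) (few k (J N))
      \<le> ennreal (real (Suc N)) * ennreal (2 ^ k * ?s ^ card (J N))"
      using emeasure_few_le(2)[OF J(1)] by (intro mult_mono) (auto simp: ennreal_of_nat_eq_real_of_nat)
    also have "\<dots> = ennreal (2 ^ k * (of_nat (Suc N) * ?s ^ N))"
      using s by (subst ennreal_mult'[symmetric]) (auto simp: J mult_ac)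
    finally show "of_nat (Suc N) * emeasure (config_space F) (few k (J N))
      \<le> ennreal (2 ^ k * (of_nat (Suc N) * ?s ^ N))" .
  qed auto
  also have "\<dots> < \<infinity>"
    using sm s by (subst suminf_ennreal2) auto
  finally show ?thesis .
qed

end

section \<open>Deterministic bounds on edge lengths\<close>

text \<open>The empty set is the default of \<open>uniform_subset\<close>, taken when the family of
  admissible sets is empty or infinite.\<close>

lemma set_uniform_subset: "set_pmf (uniform_subset L k) \<subseteq> insert {} {S. S \<subseteq> L \<and> card S = k}"
proof (cases "finite {S. S \<subseteq> L \<and> card S = k} \<and> {S. S \<subseteq> L \<and> card S = k} \<noteq> {}")
  case True
  then have "set_pmf (uniform_subset L k) = {S. S \<subseteq> L \<and> card S = k}"
    unfolding uniform_subset_def Let_def by (simp only: if_True set_pmf_of_set simp_thms)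
  then show ?thesis by blast
next
  case False
  then have "uniform_subset L k = return_pmf {}"
    unfolding uniform_subset_def Let_def by (rule if_not_P)
  then show ?thesis by (simp only: set_return_pmf) blast
qed

lemma uniform_bij_inj:
  assumes "finite S" "finite R" "card S = card R" "f \<in> set_pmf (uniform_bij S R)"
  shows "bij_betw f S R"
proof -
  let ?X = "{f. f \<in> S \<rightarrow>\<^sub>E R \<and> bij_betw f S R}"
  obtain g where "bij_betw g S R" using assms(1-3) by (metis finite_same_card_bij)
  then have "bij_betw (restrict g S) S R"
    by (rule iffD1[OF bij_betw_cong, rotated]) simp
  then have "restrict g S \<in> ?X" by (auto simp: bij_betw_def)
  then have "?X \<noteq> {}" by blast
  moreover have "finite ?X" using finite_PiE[of S "\<lambda>_. R"] assms(1,2) by (rule_tac finite_subset) auto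
  ultimately show ?thesis using assms(4) by (simp add: uniform_bij_def)
qed

text \<open>The list is distinct, so the origin occurs in at most one pair, and that edge has length
  at most \<open>m\<close>.\<close>

lemma sum_len_at_pairs_le:
  assumes "distinct H" "set H \<subseteq> {-int m..int m}"
  shows "sum_list (map (len_at 0) (pairs_of H)) \<le> (if 0 \<in> set H then m else 0)"
  using assms
proof (induction H rule: pairs_of.induct)
  case (1 a b rest)
  define t where "t = sum_list (map (len_at 0) (pairs_of rest))"
  have "t \<le> (if 0 \<in> set rest then m else 0)" using 1 by (auto simp: t_def)
  moreover have "len_at 0 (a, b) \<le> (if a = 0 \<or> b = 0 then m else 0)"
    using 1 by (auto simp: len_at_def)
  moreover have "sum_list (map (len_at 0) (pairs_of (a # b # rest))) = len_at 0 (a, b) + t"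
    by (simp add: t_def)
  ultimately show ?case using 1(2) by (auto split: if_splits)
qed simp_all

text \<open>The origin occurs at most once as \<open>k\<close> and at most \<open>c\<close> times as
  \<open>g k\<close>, each time in an edge of length at most \<open>m\<close>. Step 1 produces both
  orders of the endpoints.\<close>

lemma sum_len_at_le:
  assumes "finite S" "S \<subseteq> {-int m..int m}" "\<And>k. k \<in> S \<Longrightarrow> g k \<in> {-int m..int m}"
    and "card {k\<in>S. g k = 0} \<le> c"
    and "\<And>k. e k = (k, g k) \<or> e k = (g k, k)"
  shows "sum_mset (image_mset (len_at 0) (image_mset e (mset_set S))) \<le> m * (c + 1)"
proof -
  have "sum_mset (image_mset (len_at 0) (image_mset e (mset_set S))) = (\<Sum>k\<in>S. len_at 0 (e k))"
    by (simp add: sum_unfold_sum_mset multiset.map_comp comp_def)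
  also have "\<dots> \<le> (\<Sum>k\<in>S. (if k = 0 then m else 0) + (if g k = 0 then m else 0))"
  proof (rule sum_mono)
    fix k assume "k \<in> S"
    then have "k \<in> {-int m..int m}" "g k \<in> {-int m..int m}" using assms(2,3) by auto
    then show "len_at 0 (e k) \<le> (if k = 0 then m else 0) + (if g k = 0 then m else 0)"
      using assms(5)[of k] by (auto simp: len_at_def)
  qed
  also have "\<dots> = (if 0 \<in> S then m else 0) + card {k\<in>S. g k = 0} * m"
    using assms(1) by (simp add: sum.distrib sum.inter_filter[symmetric])
  also have "\<dots> \<le> m + c * m"
    using assms(4) by (intro add_mono mult_right_mono) auto
  finally show ?thesis by (simp add: algebra_simps)
qed

text \<open>The origin has at most \<open>trunc d D 0\<close> edges from remaining bad stubs, one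
  from the pairing of high vertices and one from being chosen as a low vertex. All of them stay
  inside \<open>C\<close>.\<close>

lemma step1_cluster_len_le:
  assumes "finite C" "C \<subseteq> {-int m..int m}" and E: "E \<in> set_pmf (step1_cluster d D C)"
  shows "sum_mset (image_mset (len_at 0) E) \<le> (trunc d D 0 + 2) * m"
proof -
  define H where "H = highs d D C"
  define L where "L = lows d D C"
  have finL: "finite L" "L \<subseteq> {-int m..int m}" using assms(1,2) by (auto simp: L_def lows_def)
  have "finite {i\<in>C. high d D i}" using assms(1) by simp
  then have H: "distinct H" "set H \<subseteq> {-int m..int m}"
    using assms(1,2) by (auto simp: H_def highs_def)
  consider "length H = 0" | "length H = 1" | "length H \<noteq> 0" "length H \<noteq> 1" by blast
  then show ?thesis
  proof cases
    case 1
    then have "E = {#}" using E by (simp add: step1_cluster_def H_def[symmetric] Let_def)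
    then show ?thesis by simp
  next
    case 2
    then have "step1_cluster d D C =
        map_pmf (\<lambda>S. image_mset (\<lambda>k. (hd H, k)) (mset_set S)) (uniform_subset L (trunc d D (hd H)))"
      unfolding H_def L_def step1_cluster_def Let_def by simp
    then obtain S where S: "S \<in> set_pmf (uniform_subset L (trunc d D (hd H)))"
      "E = image_mset (\<lambda>k. (hd H, k)) (mset_set S)"
      using E by auto
    have hH: "hd H \<in> set H" using 2 by (cases H) auto
    have S': "S = {} \<or> (S \<subseteq> L \<and> card S = trunc d D (hd H))" using S(1) set_uniform_subset by blast
    then have "finite S" "S \<subseteq> {-int m..int m}" using finL finite_subset by auto
    moreover have "card {k\<in>S. hd H = 0} \<le> trunc d D 0"
      using S' by (cases "hd H = 0") auto
    ultimately have "sum_mset (image_mset (len_at 0) E) \<le> m * (trunc d D 0 + 1)"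
      unfolding S(2) using H hH by (intro sum_len_at_le[where g="\<lambda>_. hd H"]) auto
    then show ?thesis by (simp add: algebra_simps)
  next
    case 3
    define Q where "Q = (if even (length H) then return_pmf (pairs_of H)
       else map_pmf (\<lambda>b. if b then pairs_of (butlast H) else pairs_of (tl H)) (bernoulli_pmf (1/2)))"
    have "step1_cluster d D C = bind_pmf Q (\<lambda>P. bind_pmf (uniform_subset L (card (bad_remaining d D H P)))
        (\<lambda>S. map_pmf (\<lambda>f. mset P + image_mset (\<lambda>k. (k, fst (f k))) (mset_set S))
          (uniform_bij S (bad_remaining d D H P))))"
      using 3 unfolding Q_def H_def L_def step1_cluster_def Let_def by simp
    then obtain P S f where Q: "P \<in> set_pmf Q"
      and S: "S \<in> set_pmf (uniform_subset L (card (bad_remaining d D H P)))"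
      and f: "f \<in> set_pmf (uniform_bij S (bad_remaining d D H P))"
      and E': "E = mset P + image_mset (\<lambda>k. (k, fst (f k))) (mset_set S)"
      using E by (auto simp: set_bind_pmf)
    have P: "P = pairs_of H \<or> P = pairs_of (butlast H) \<or> P = pairs_of (tl H)"
      using Q by (auto simp: Q_def split: if_splits)
    define R where "R = bad_remaining d D H P"
    have RS: "R \<subseteq> Sigma (set H) (\<lambda>i. {1..trunc d D i})"
      by (auto simp: R_def bad_remaining_def)
    then have finR: "finite R" by (rule finite_subset) auto
    have "sum_list (map (len_at 0) (pairs_of H')) \<le> m" if "distinct H'" "set H' \<subseteq> set H" for H'
      by (rule order_trans[OF sum_len_at_pairs_le[OF that(1)]]) (use that H in auto)
    moreover have "set (butlast H) \<subseteq> set H" by (auto dest: in_set_butlastD)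
    moreover have "set (tl H) \<subseteq> set H" by (cases H) auto
    ultimately have p: "sum_list (map (len_at 0) P) \<le> m"
      using P H(1) by (auto simp: distinct_butlast distinct_tl)
    have S': "S = {} \<or> (S \<subseteq> L \<and> card S = card R)" using S set_uniform_subset unfolding R_def by blast
    then have finS: "finite S" "S \<subseteq> {-int m..int m}" using finL finite_subset by auto
    have "sum_mset (image_mset (len_at 0) (image_mset (\<lambda>k. (k, fst (f k))) (mset_set S)))
        \<le> m * (trunc d D 0 + 1)"
    proof (cases "S = {}")
      case False
      then have bij: "bij_betw f S R"
        using S' finS finR f uniform_bij_inj unfolding R_def by blast
      have fR: "f k \<in> R" if "k \<in> S" for k using bij that by (auto simp: bij_betw_def)
      \<comment> \<open>\<open>f\<close> is injective and the stubs at the origin carry labels up to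
        \<open>trunc d D 0\<close>, so the origin is hit at most that often.\<close>
      have "f ` {k\<in>S. fst (f k) = 0} \<subseteq> {0} \<times> {1..trunc d D 0}"
        using fR RS by fastforce
      then have "card (f ` {k\<in>S. fst (f k) = 0}) \<le> trunc d D 0"
        using card_mono[of "{0::int} \<times> {1..trunc d D 0}"] by fastforce
      moreover have "inj_on f {k\<in>S. fst (f k) = 0}"
        using bij by (auto simp: bij_betw_def inj_on_def)
      ultimately have "card {k\<in>S. fst (f k) = 0} \<le> trunc d D 0"
        by (simp add: card_image)
      moreover have "fst (f k) \<in> {-int m..int m}" if "k \<in> S" for k
        using fR[OF that] RS H(2) by (cases "f k") auto
      ultimately show ?thesis
        using finS by (intro sum_len_at_le[where g="\<lambda>k. fst (f k)"]) auto
    qed simp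
    then have "sum_mset (image_mset (len_at 0) E) \<le> m + m * (trunc d D 0 + 1)"
      unfolding E' using p
      by (simp only: image_mset_union sum_mset.union mset_map[symmetric] sum_mset_sum_list add_mono)
    then show ?thesis by (simp add: algebra_simps)
  qed
qed

text \<open>The cluster of the origin lies in \<open>[-m, m]\<close> with
  \<open>m \<le> spread d D + 2\<close>. For infinite \<open>spread\<close> the bound is infinite,
  and an unclaimed origin has no step-1 edge.\<close>

lemma AE_step1_len_le:
  "AE S in step1_space d D.
     of_nat (sum_mset (image_mset (len_at 0) (edges1 d D S 0))) \<le> of_nat (trunc d D 0 + 2) * (spread d D + 2)"
proof (cases "spread d D < \<infinity> \<and> claimed d D 0")
  case False
  then have "spread d D = \<top> \<or> \<not> claimed d D 0" by (auto simp: less_top)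
  then show ?thesis by (intro AE_I2) (auto simp: edges1_def ennreal_mult_top)
next
  case True
  obtain N where N: "spread d D \<le> of_nat N" "of_nat N \<le> spread d D + 1"
    using True ennreal_nat_upper by blast
  \<comment> \<open>The successor keeps \<open>m\<close> positive, as \<open>clust_0_subset\<close>
    requires, at the cost of one more unit.\<close>
  define m where "m = Suc N"
  have m: "spread d D \<le> of_nat m" "of_nat m \<le> spread d D + 2" "m > 0"
  proof -
    show "spread d D \<le> of_nat m" using N(1) by (rule order_trans) (simp add: m_def)
    show "of_nat m \<le> spread d D + 2"
    proof -
      have "of_nat m = of_nat N + (1 :: ennreal)" by (simp add: m_def add.commute)
      also have "\<dots> \<le> spread d D + 1 + 1" by (rule add_right_mono[OF N(2)])
      finally show ?thesis by (simp only: add.assoc one_add_one)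
    qed
  qed (simp add: m_def)
  define C where "C = clust d D 0"
  have C: "finite C" "C \<subseteq> {-int m..int m}"
    using finite_clust clust_0_subset True m by (auto simp: C_def)
  have "0 \<in> C" using True by (simp add: C_def clust_def)
  then have minC: "Min C \<in> C" using C(1) by (intro Min_in) auto
  then have cl: "clust d D (Min C) = C" unfolding C_def by (rule clust_eqI)
  have "Min C \<in> {min 0 (Min C)..max 0 (Min C)}" by simp
  then have "claimed d D (Min C)" using minC unfolding C_def clust_def by blast
  then have at: "step1_at d D (Min C) = step1_cluster d D C"
    using C(1) by (simp add: step1_at_def cl)
  have "AE S in step1_space d D. S (Min C) \<in> set_pmf (step1_at d D (Min C))"
    unfolding step1_space_def
    by (rule AE_PiM_component[where P="\<lambda>x. x \<in> set_pmf (step1_at d D (Min C))"])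
       (auto simp: prob_space_measure_pmf AE_measure_pmf)
  then show ?thesis
  proof eventually_elim
    case (elim S)
    have "edges1 d D S 0 = S (Min C)" using True C(1) by (simp add: edges1_def C_def)
    then have "sum_mset (image_mset (len_at 0) (edges1 d D S 0)) \<le> (trunc d D 0 + 2) * m"
      using step1_cluster_len_le[OF C] elim at by simp
    then have "(of_nat (sum_mset (image_mset (len_at 0) (edges1 d D S 0))) :: ennreal)
        \<le> of_nat ((trunc d D 0 + 2) * m)" by (rule of_nat_mono)
    also have "\<dots> \<le> of_nat (trunc d D 0 + 2) * (spread d D + 2)"
      unfolding of_nat_mult by (intro mult_left_mono m) auto
    finally show ?case .
  qed
qed

text \<open>With \<open>w = 1\<close> this is the distance from the origin to the \<open>k\<close>-th point of \<open>G\<close> in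
  direction \<open>b\<close>.\<close>

definition gap :: "(nat \<Rightarrow> nat) \<Rightarrow> int set \<Rightarrow> nat \<Rightarrow> bool \<Rightarrow> ennreal" where
  "gap w G k b = (\<Sum>N. of_nat (w N) * (if card (G \<inter> seg b N) < k then 1 else 0))"

lemma sum_le_gap:
  assumes "\<And>N. N < n \<Longrightarrow> v N \<noteq> 0 \<Longrightarrow> v N \<le> w N \<and> card (G \<inter> seg b N) < k"
  shows "of_nat (\<Sum>N<n. v N) \<le> gap w G k b"
proof -
  have "(of_nat (\<Sum>N<n. v N) :: ennreal) = (\<Sum>N<n. of_nat (v N))" by simp
  also have "\<dots> \<le> (\<Sum>N<n. of_nat (w N) * (if card (G \<inter> seg b N) < k then 1 else 0))"
  proof (rule sum_mono)
    fix N assume "N \<in> {..<n}"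
    then show "(of_nat (v N) :: ennreal) \<le> of_nat (w N) * (if card (G \<inter> seg b N) < k then 1 else 0)"
      using assms[of N] by (cases "v N = 0") (auto intro!: of_nat_mono)
  qed
  also have "\<dots> \<le> gap w G k b"
    unfolding gap_def by (intro sum_le_suminf summableI) auto
  finally show ?thesis .
qed

text \<open>For each \<open>N\<close> below the distance to the partner, the segment of length
  \<open>N\<close> stops short of it and holds at most \<open>2 * j - 2\<close> points of
  \<open>G\<close>, hence of \<open>G'\<close>. Each such \<open>N\<close> adds 1 to the
  gap.\<close>

lemma ct_len_le_gap:
  assumes "j \<ge> 1" "G' \<subseteq> G"
  shows "of_nat (ct_len G j 0 b) \<le> gap (\<lambda>_. 1) G' (2 * j - 1) b"
proof -
  define Q where "Q x = (if b then {0<..<x} else {x<..<(0::int)})" for x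
  define Z where "Z = {x\<in>G. (if b then 0 < x else x < 0) \<and> card (G \<inter> Q x) = 2 * j - 2}"
  have ct: "ct_len G j 0 b = (\<Sum>x\<in>Z. nat \<bar>x\<bar>)"
    unfolding ct_len_def Z_def Q_def by (rule sum.cong) auto
  have finQ: "finite (G \<inter> Q x)" for x by (auto simp: Q_def)
  have less: "card (G \<inter> Q x) < card (G \<inter> Q y)" if "x \<in> Z" "y \<in> Z" "\<bar>x\<bar> < \<bar>y\<bar>" for x y
    using that by (intro psubset_card_mono finQ) (auto simp: Z_def Q_def split: if_splits)
  \<comment> \<open>The number of points of \<open>G\<close> passed grows strictly along
    \<open>G\<close>, so the sum in \<open>ct_len\<close> has at most one term.\<close>
  have uniq: "x = y" if "x \<in> Z" "y \<in> Z" for x y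
  proof -
    have "card (G \<inter> Q x) = card (G \<inter> Q y)" using that by (simp add: Z_def)
    then have "\<bar>x\<bar> = \<bar>y\<bar>" using less[of x y] less[of y x] that by (metis less_irrefl linorder_neqE)
    then show ?thesis using that by (auto simp: Z_def split: if_splits)
  qed
  show ?thesis
  proof (cases "Z = {}")
    case False
    then obtain x where x: "x \<in> Z" by blast
    then have "Z = {x}" using uniq by blast
    then have "ct_len G j 0 b = (\<Sum>N<nat \<bar>x\<bar>. 1)" by (simp add: ct)
    also have "of_nat \<dots> \<le> gap (\<lambda>_. 1) G' (2 * j - 1) b"
    proof (rule sum_le_gap)
      fix N assume "N < nat \<bar>x\<bar>"
      then have "G' \<inter> seg b N \<subseteq> G \<inter> Q x"
        using assms(2) x by (auto simp: seg_def Q_def Z_def split: if_splits)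
      then have "card (G' \<inter> seg b N) \<le> card (G \<inter> Q x)" by (rule card_mono[OF finQ])
      also have "\<dots> = 2 * j - 2" using x by (simp add: Z_def)
      finally show "1 \<le> (1::nat) \<and> card (G' \<inter> seg b N) < 2 * j - 1" using assms(1) by simp
    qed
    finally show ?thesis by simp
  qed (simp add: ct)
qed

text \<open>At most \<open>d div 2\<close> high vertices separate the origin from a neighbour at
  distance \<open>N + 1\<close>, so that distance appears in the gap as the weight
  \<open>Suc N\<close>. A sum over an infinite neighbour set is 0 by convention.\<close>

lemma step2_len_le_gap:
  "of_nat (\<Sum>b\<in>step2_nbrs d D 0. nat \<bar>b\<bar>)
    \<le> gap Suc {x. high d D x} (d div 2 + 1) True + gap Suc {x. high d D x} (d div 2 + 1) False"
proof (cases "finite (step2_nbrs d D 0)")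
  case True
  let ?Q = "step2_nbrs d D 0"
  define f where "f k = (if k \<in> ?Q then nat \<bar>k\<bar> else 0)" for k
  define n where "n = (\<Sum>k\<in>?Q. nat \<bar>k\<bar>)"
  have "nat \<bar>k\<bar> \<le> n" if "k \<in> ?Q" for k
    unfolding n_def using True that by (intro member_le_sum) auto
  then have sub: "?Q \<subseteq> {-int n..int n}" by fastforce
  have Q: "card {x. high d D x \<and> min 0 k < x \<and> x < max 0 k} < d div 2 + 1" if "k \<in> ?Q" for k
    using that by (auto simp: step2_nbrs_def)
  have r: "of_nat (\<Sum>k<n. f (1 + int k * 1)) \<le> gap Suc {x. high d D x} (d div 2 + 1) True"
  proof (rule sum_le_gap)
    fix N assume nz: "f (1 + int N * 1) \<noteq> 0"
    then have "1 + int N \<in> ?Q" by (auto simp: f_def split: if_splits)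
    moreover have "{x. high d D x} \<inter> seg True N = {x. high d D x \<and> min 0 (1 + int N) < x \<and> x < max 0 (1 + int N)}"
      by (auto simp: seg_def)
    ultimately show "f (1 + int N * 1) \<le> Suc N \<and> card ({x. high d D x} \<inter> seg True N) < d div 2 + 1"
      using Q[of "1 + int N"] by (simp add: f_def)
  qed
  have l: "of_nat (\<Sum>k<n. f (-1 + int k * -1)) \<le> gap Suc {x. high d D x} (d div 2 + 1) False"
  proof (rule sum_le_gap)
    fix N assume nz: "f (-1 + int N * -1) \<noteq> 0"
    then have "-1 - int N \<in> ?Q" by (auto simp: f_def split: if_splits)
    moreover have "{x. high d D x} \<inter> seg False N = {x. high d D x \<and> min 0 (-1 - int N) < x \<and> x < max 0 (-1 - int N)}"
      by (auto simp: seg_def)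
    ultimately show "f (-1 + int N * -1) \<le> Suc N \<and> card ({x. high d D x} \<inter> seg False N) < d div 2 + 1"
      using Q[of "-1 - int N"] by (simp add: f_def)
  qed
  have "(\<Sum>b\<in>?Q. nat \<bar>b\<bar>) = (\<Sum>k\<in>{-int n..int n}. f k)"
    unfolding f_def using sub by (simp add: sum.If_cases Int_absorb1)
  also have "\<dots> = (\<Sum>k<n. f (1 + int k * 1)) + (\<Sum>k<n. f (-1 + int k * -1))"
    unfolding sum_symmetric_interval by (simp add: f_def)
  finally show ?thesis using add_mono[OF r l] by (simp only: of_nat_add)
qed simp

section \<open>Integrability\<close>

lemma nn_integral_config_coord:
  "(\<integral>\<^sup>+D. f (D i) * g D \<partial>config_space F) = (\<integral>\<^sup>+x. f x \<partial>measure_pmf F) * (\<integral>\<^sup>+D. g D \<partial>config_space F)"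
  if [measurable]: "g \<in> borel_measurable (config_space F)" and g: "\<And>D x. g (D(i := x)) = g D"
proof -
  have "(\<integral>\<^sup>+D. f (D i) * g D \<partial>config_space F)
    = (\<integral>\<^sup>+D. (\<integral>\<^sup>+x. f x * g D \<partial>measure_pmf F) \<partial>config_space F)"
    by (subst nn_integral_config_resample[where i=i]) (simp_all add: g)
  also have "\<dots> = (\<integral>\<^sup>+D. (\<integral>\<^sup>+x. f x \<partial>measure_pmf F) * g D \<partial>config_space F)"
    by (simp add: nn_integral_multc)
  finally show ?thesis by (simp add: nn_integral_cmult)
qed

lemma nn_integral_config_coord':
  "(\<integral>\<^sup>+D. f (D i) \<partial>config_space F) = (\<integral>\<^sup>+x. f x \<partial>measure_pmf F)"
  using nn_integral_config_coord[of "\<lambda>_. 1" F i f] prob_space.emeasure_space_1[OF prob_space_config, of F]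
  by simp

text \<open>A gap may have infinite mean if the class \<open>A\<close> has probability zero, but
  then \<open>D i \<in> A\<close> is a null event. This covers laws that miss some degrees.\<close>

lemma nn_integral_config_if_less_top:
  fixes A :: "nat set"
  assumes [measurable]: "g \<in> borel_measurable (config_space F)"
    and fin: "measure_pmf.prob F A > 0 \<Longrightarrow> (\<integral>\<^sup>+D. g D \<partial>config_space F) < \<infinity>"
  shows "(\<integral>\<^sup>+D. (if D i \<in> A then g D else 0) \<partial>config_space F) < \<infinity>"
proof (cases "measure_pmf.prob F A > 0")
  case True
  have "(\<integral>\<^sup>+D. (if D i \<in> A then g D else 0) \<partial>config_space F) \<le> (\<integral>\<^sup>+D. g D \<partial>config_space F)"
    by (intro nn_integral_mono) auto
  also have "\<dots> < \<infinity>" using fin True by simp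
  finally show ?thesis .
next
  case False
  then have "measure_pmf.prob F A = 0" using measure_nonneg[of F A] by linarith
  then have "(\<integral>\<^sup>+D. indicator A (D i) \<partial>config_space F) = 0"
    by (subst nn_integral_config_coord') (simp add: measure_pmf.emeasure_eq_measure)
  then have "AE D in config_space F. indicator A (D i) = (0::ennreal)"
    by (subst (asm) nn_integral_0_iff_AE) auto
  then have "AE D in config_space F. (if D i \<in> A then g D else 0) = 0"
    by eventually_elim (auto simp: indicator_def split: if_splits)
  then have "(\<integral>\<^sup>+D. (if D i \<in> A then g D else 0) \<partial>config_space F) = 0"
    by (subst nn_integral_0_iff_AE) auto
  then show ?thesis by simp
qed

section \<open>Measurability and finite mean of gaps\<close>

lemma measurable_claimed [measurable]: "Measurable.pred (config_space F) (\<lambda>D. claimed d D i)"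
  unfolding claimed_def trunc_def by measurable

lemma measurable_gap:
  assumes [measurable]: "\<And>x. Measurable.pred (config_space F) (\<lambda>D. x \<in> G D)"
  shows "(\<lambda>D. gap w (G D) k b) \<in> borel_measurable (config_space F)"
proof -
  have card_eq: "card (G D \<inter> seg b N) = (\<Sum>x\<in>seg b N. if x \<in> G D then 1 else 0)" for D N
    using seg_props(1)[of b N] by (simp add: sum.If_cases Int_commute)
  show ?thesis unfolding gap_def card_eq by measurable
qed

lemma suminf_less_ennreal_le: "(\<Sum>N. if of_nat N < x then 1 else 0) \<le> x + (1::ennreal)"
proof (cases "x < \<infinity>")
  case True
  then obtain n where n: "x \<le> of_nat n" "of_nat n \<le> x + 1" by (rule ennreal_nat_upper)
  have "(\<Sum>N. if of_nat N < x then 1 else 0) = (\<Sum>N<n. if of_nat N < x then 1 else (0::ennreal))"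
  proof (rule suminf_finite)
    fix N assume "N \<notin> {..<n}"
    then have "x \<le> of_nat N" using n(1) by (auto intro: order_trans of_nat_mono)
    then show "(if of_nat N < x then 1 else (0::ennreal)) = 0" by auto
  qed simp
  also have "\<dots> \<le> (\<Sum>N<n. 1)" by (intro sum_mono) auto
  also have "\<dots> \<le> x + 1" using n by simp
  finally show ?thesis .
next
  case False
  then have "x = \<top>" by (simp add: less_top[symmetric])
  then show ?thesis by simp
qed

text \<open>With \<open>U\<close> the whole line the quarter condition in \<open>few\<close> always
  holds, and thinning is a tail bound for independent trials.\<close>

lemma nn_integral_gap_high_less_top:
  assumes "measure_pmf.prob F {d<..} > 0"
  shows "(\<integral>\<^sup>+D. gap Suc {x. high d D x} k b \<partial>config_space F) < \<infinity>"
proof -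
  interpret thinning F "{d<..}" UNIV "\<lambda>_. UNIV" by unfold_locales auto
  have [measurable]: "few k (seg b N) \<in> sets (config_space F)" for N
    by (intro emeasure_few_le seg_props)
  have eq: "gap Suc {x. high d D x} k b = (\<Sum>N. of_nat (Suc N) * indicator (few k (seg b N)) D)" for D
    unfolding gap_def by (intro suminf_cong arg_cong2[where f="(*)"] refl)
      (auto simp: few_def indicator_def high_def Int_def conj_commute)
  have "(\<integral>\<^sup>+D. gap Suc {x. high d D x} k b \<partial>config_space F)
      = (\<Sum>N. of_nat (Suc N) * emeasure (config_space F) (few k (seg b N)))"
    unfolding eq by (subst nn_integral_suminf) (auto simp: nn_integral_cmult simp del: of_nat_Suc)
  also have "\<dots> < \<infinity>" by (intro suminf_few_less_top assms seg_props)
  finally show ?thesis .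
qed

text \<open>The window with \<open>m = 1\<close> already claims a high vertex. This yields
  \<open>U_B\<close> for the unclaimed set with \<open>B = {..d}\<close>.\<close>

lemma unclaimed_le: "\<not> claimed d D x \<Longrightarrow> D x \<le> d"
proof (rule ccontr)
  assume nc: "\<not> claimed d D x" and "\<not> D x \<le> d"
  then have "1 \<le> trunc d D x" by (simp add: trunc_def)
  also have "\<dots> \<le> (\<Sum>k\<in>{x - int 1..x + int 1}. trunc d D k)" by (rule member_le_sum) auto
  finally show False using nc unfolding claimed_def by blast
qed

text \<open>Fewer than \<open>k\<close> points up to \<open>N\<close> can have two causes:
  \<open>N < spread d D\<close>, or unclaimed vertices abound and \<open>few\<close> occurs. The
  first contributes at most \<open>spread d D + 1\<close>, the second a convergent series of
  probabilities.\<close>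

lemma nn_integral_gap_unclaimed_less_top:
  assumes p: "measure_pmf.prob F {j..d} > 0" and sp: "(\<integral>\<^sup>+D. spread d D \<partial>config_space F) < \<infinity>"
  shows "(\<integral>\<^sup>+D. gap (\<lambda>_. 1) {x. \<not> claimed d D x \<and> D x \<in> {j..d}} k b \<partial>config_space F) < \<infinity>"
proof -
  interpret C: prob_space "config_space F" by simp
  interpret thinning F "{j..d}" "{..d}" "\<lambda>D. {x. \<not> claimed d D x}"
  proof
    fix D :: config and i x assume "D i \<in> {..d}" "x \<in> {..d}"
    \<comment> \<open>All degrees up to \<open>d\<close> mean zero bad stubs, so exchanging one for
      another leaves the claimed set alone.\<close>
    then have "trunc d (D(i := x)) = trunc d D" by (auto simp: trunc_def)
    then show "{xa. \<not> claimed d (D(i := x)) xa} = {x. \<not> claimed d D x}"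
      by (simp add: claimed_def)
  qed (auto simp: unclaimed_le)
  have [measurable]: "few k (seg b N) \<in> sets (config_space F)" for N
    by (intro emeasure_few_le seg_props)
  let ?G = "\<lambda>D. {x. \<not> claimed d D x \<and> D x \<in> {j..d}}"
  have le: "gap (\<lambda>_. 1) (?G D) k b \<le> (\<Sum>N. of_nat (Suc N) * indicator (few k (seg b N)) D) + (spread d D + 1)" for D
  proof -
    have "gap (\<lambda>_. 1) (?G D) k b
        \<le> (\<Sum>N. of_nat (Suc N) * indicator (few k (seg b N)) D + (if of_nat N < spread d D then 1 else 0))"
      unfolding gap_def
    proof (intro suminf_le summableI)
      fix N
      show "of_nat 1 * (if card (?G D \<inter> seg b N) < k then 1 else 0)
        \<le> of_nat (Suc N) * indicator (few k (seg b N)) D + (if of_nat N < spread d D then 1 else (0::ennreal))"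
      proof (cases "card (?G D \<inter> seg b N) < k \<and> \<not> of_nat N < spread d D")
        case True
        then have "N \<le> 4 * card ({x. \<not> claimed d D x} \<inter> seg b N)"
          by (intro card_unclaimed_ge seg_props) auto
        moreover have "{x. \<not> claimed d D x} \<inter> seg b N = {i \<in> seg b N. \<not> claimed d D i}"
          "?G D \<inter> seg b N = {i \<in> seg b N. \<not> claimed d D i \<and> D i \<in> {j..d}}" by auto
        ultimately have "D \<in> few k (seg b N)" using True by (simp add: few_def seg_props)
        then show ?thesis by (simp add: add_increasing2)
      qed (auto simp: add_increasing)
    qed
    also have "\<dots> = (\<Sum>N. of_nat (Suc N) * indicator (few k (seg b N)) D)
        + (\<Sum>N. if of_nat N < spread d D then 1 else 0)"
      by (intro suminf_add[symmetric] summableI)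
    also have "\<dots> \<le> (\<Sum>N. of_nat (Suc N) * indicator (few k (seg b N)) D) + (spread d D + 1)"
      by (intro add_left_mono suminf_less_ennreal_le)
    finally show ?thesis .
  qed
  have "(\<integral>\<^sup>+D. gap (\<lambda>_. 1) (?G D) k b \<partial>config_space F)
      \<le> (\<integral>\<^sup>+D. (\<Sum>N. of_nat (Suc N) * indicator (few k (seg b N)) D) + (spread d D + 1) \<partial>config_space F)"
    by (intro nn_integral_mono le)
  also have "\<dots> = (\<Sum>N. of_nat (Suc N) * emeasure (config_space F) (few k (seg b N)))
      + ((\<integral>\<^sup>+D. spread d D \<partial>config_space F) + 1)"
    using C.emeasure_space_1
    by (simp add: nn_integral_add nn_integral_suminf nn_integral_cmult del: of_nat_Suc)
  also have "\<dots> < \<infinity>"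
    using suminf_few_less_top[OF p, of "seg b" k] sp by (auto simp: seg_props less_top[symmetric] simp del: of_nat_Suc)
  finally show ?thesis .
qed

text \<open>Unclaimed vertices keep all their stubs whatever the outcome of step 1, so the gaps of
  \<open>Gamma\<close> are dominated by gaps of a set that depends on the degrees only.\<close>

lemma step3_len_le_gap:
  assumes "\<not> high d D 0"
  shows "of_nat (\<Sum>j\<in>{1..Dprime d D S 0}. ct_len (Gamma d D S j) j 0 (r j))
    \<le> (\<Sum>j\<in>{1..d}. if D 0 \<in> {j..d}
          then (\<Sum>b\<in>UNIV. gap (\<lambda>_. 1) {x. \<not> claimed d D x \<and> D x \<in> {j..d}} (2 * j - 1) b) else 0)"
proof -
  let ?g = "\<lambda>j b. gap (\<lambda>_. 1) {x. \<not> claimed d D x \<and> D x \<in> {j..d}} (2 * j - 1) b"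
  have D0: "D 0 \<le> d" "Dprime d D S 0 \<le> D 0" using assms by (auto simp: high_def Dprime_def)
  have "(of_nat (ct_len (Gamma d D S j) j 0 (r j)) :: ennreal) \<le> (\<Sum>b\<in>UNIV. ?g j b)" if "j \<ge> 1" for j
  proof -
    have "{x. \<not> claimed d D x \<and> D x \<in> {j..d}} \<subseteq> Gamma d D S j"
      by (auto simp: Gamma_def Dprime_def high_def deg1_def edges1_def)
    then have "of_nat (ct_len (Gamma d D S j) j 0 (r j)) \<le> ?g j (r j)"
      by (intro ct_len_le_gap that)
    also have "\<dots> \<le> (\<Sum>b\<in>UNIV. ?g j b)" by (rule member_le_sum) auto
    finally show ?thesis .
  qed
  then have "(\<Sum>j\<in>{1..Dprime d D S 0}. of_nat (ct_len (Gamma d D S j) j 0 (r j)))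
    \<le> (\<Sum>j\<in>{1..Dprime d D S 0}. if D 0 \<in> {j..d} then (\<Sum>b\<in>UNIV. ?g j b) else 0)"
    using D0 by (intro sum_mono) auto
  also have "\<dots> \<le> (\<Sum>j\<in>{1..d}. if D 0 \<in> {j..d} then (\<Sum>b\<in>UNIV. ?g j b) else 0)"
    using D0 by (intro sum_mono2) auto
  finally show ?thesis by simp
qed

text \<open>A majorant in the degrees alone, one summand per step. The conditions on
  \<open>D 0\<close> make degree classes of probability zero drop out.\<close>

definition T_bound :: "nat \<Rightarrow> config \<Rightarrow> ennreal" where
  "T_bound d D = of_nat (trunc d D 0 + 2) * (spread d D + 2)
     + (if D 0 \<in> {d<..} then (\<Sum>b\<in>UNIV. gap Suc {x. high d D x} (d div 2 + 1) b) else 0)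
     + (\<Sum>j\<in>{1..d}. if D 0 \<in> {j..d}
          then (\<Sum>b\<in>UNIV. gap (\<lambda>_. 1) {x. \<not> claimed d D x \<and> D x \<in> {j..d}} (2 * j - 1) b) else 0)"

lemma AE_T_le: "AE S in step1_space d D. \<forall>c. of_nat (T d D S c) \<le> T_bound d D"
  using AE_step1_len_le
proof eventually_elim
  case (elim S)
  show ?case
  proof
    fix c
    have 2: "(of_nat (if high d D 0 then (\<Sum>b\<in>step2_nbrs d D 0. nat \<bar>b\<bar>) else 0) :: ennreal)
        \<le> (if D 0 \<in> {d<..} then (\<Sum>b\<in>UNIV. gap Suc {x. high d D x} (d div 2 + 1) b) else 0)"
      using step2_len_le_gap[of d D] by (auto simp: high_def UNIV_bool add.commute)
    have 3: "(of_nat (if high d D 0 then 0 else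
          (\<Sum>j\<in>{1..Dprime d D S 0}. ct_len (Gamma d D S j) j 0 (ct_right c (Gamma d D S j) j 0))) :: ennreal)
        \<le> (\<Sum>j\<in>{1..d}. if D 0 \<in> {j..d}
          then (\<Sum>b\<in>UNIV. gap (\<lambda>_. 1) {x. \<not> claimed d D x \<and> D x \<in> {j..d}} (2 * j - 1) b) else 0)"
    proof (cases "high d D 0")
      case False
      then show ?thesis unfolding if_not_P[OF False] by (rule step3_len_le_gap)
    qed simp
    show "of_nat (T d D S c) \<le> T_bound d D"
      using add_mono[OF add_mono[OF elim 2] 3] unfolding T_def T_bound_def by (simp only: of_nat_add)
  qed
qed

lemma expected_T_le: "expected_T F d \<le> (\<integral>\<^sup>+D. T_bound d D \<partial>config_space F)"
  unfolding expected_T_def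
proof (rule nn_integral_mono)
  fix D
  interpret S: prob_space "step1_space d D"
    unfolding step1_space_def by (intro prob_space_PiM prob_space_measure_pmf)
  interpret K: prob_space coin_space
    unfolding coin_space_def by (intro prob_space_PiM prob_space_measure_pmf)
  have "(\<integral>\<^sup>+S. (\<integral>\<^sup>+c. ennreal (real (T d D S c)) \<partial>coin_space) \<partial>step1_space d D)
      \<le> (\<integral>\<^sup>+S. T_bound d D \<partial>step1_space d D)"
  proof (rule nn_integral_mono_AE)
    show "AE S in step1_space d D. (\<integral>\<^sup>+c. ennreal (real (T d D S c)) \<partial>coin_space) \<le> T_bound d D"
      using AE_T_le
    proof eventually_elim
      case (elim S)
      then have "(\<integral>\<^sup>+c. ennreal (real (T d D S c)) \<partial>coin_space) \<le> (\<integral>\<^sup>+c. T_bound d D \<partial>coin_space)"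
        by (intro nn_integral_mono) (simp add: ennreal_of_nat_eq_real_of_nat)
      then show ?case by (simp add: K.emeasure_space_1)
    qed
  qed
  then show "(\<integral>\<^sup>+S. (\<integral>\<^sup>+c. ennreal (real (T d D S c)) \<partial>coin_space) \<partial>step1_space d D) \<le> T_bound d D"
    by (simp add: S.emeasure_space_1)
qed

section \<open>Finite mean of the majorant and choice of the truncation level\<close>

lemma nn_integral_quadratic_less_top:
  fixes F :: "nat pmf" and f :: "nat \<Rightarrow> nat"
  assumes sq: "(\<integral>\<^sup>+x. of_nat (x\<^sup>2) \<partial>measure_pmf F) < \<infinity>" and f: "\<And>x. f x \<le> c * (x\<^sup>2 + 1)"
  shows "(\<integral>\<^sup>+x. of_nat (f x) \<partial>measure_pmf F) < \<infinity>"
proof -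
  have "(\<integral>\<^sup>+x. of_nat (f x) \<partial>measure_pmf F) \<le> (\<integral>\<^sup>+x. of_nat c * (of_nat (x\<^sup>2) + 1) \<partial>measure_pmf F)"
  proof (rule nn_integral_mono)
    fix x
    show "(of_nat (f x) :: ennreal) \<le> of_nat c * (of_nat (x\<^sup>2) + 1)"
      using of_nat_mono[OF f[of x], where 'a=ennreal] by (simp add: distrib_left add.commute)
  qed
  also have "\<dots> = of_nat c * ((\<integral>\<^sup>+x. of_nat (x\<^sup>2) \<partial>measure_pmf F) + 1)"
    by (simp add: nn_integral_cmult nn_integral_add measure_pmf.emeasure_space_1 del: of_nat_power)
  also have "\<dots> < \<infinity>"
    using sq by (simp add: ennreal_mult_less_top of_nat_less_top ennreal_add_less_top del: of_nat_power)
  finally show ?thesis .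
qed

text \<open>The step-1 term is a product in which both factors contain \<open>D 0\<close>. Its part
  in \<open>D 0\<close> alone is quadratic, and the overshoots are independent of
  \<open>D 0\<close>, so second moments suffice.\<close>

lemma nn_integral_T_bound_less_top:
  assumes sq: "(\<integral>\<^sup>+x. of_nat (x\<^sup>2) \<partial>measure_pmf F) < \<infinity>"
    and mean: "(\<integral>\<^sup>+x. of_nat (2 * load d x) \<partial>measure_pmf F) \<le> 1"
  shows "(\<integral>\<^sup>+D. spread d D \<partial>config_space F) < \<infinity>" "(\<integral>\<^sup>+D. T_bound d D \<partial>config_space F) < \<infinity>"
proof -
  have quad: "a * (x - d)\<^sup>2 + b * (x - d) + e \<le> (a + b + e) * (x\<^sup>2 + 1)" for a b e x :: nat
  proof -
    have "y \<le> y\<^sup>2" for y :: nat by (simp add: power2_eq_square)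
    from order_trans[OF diff_le_self this] have "x - d \<le> x\<^sup>2 + 1" by (simp add: le_Suc_eq)
    moreover have "(x - d)\<^sup>2 \<le> x\<^sup>2 + 1" by (intro trans_le_add1 power_mono) auto
    ultimately have "a * (x - d)\<^sup>2 + b * (x - d) + e * 1 \<le> a * (x\<^sup>2 + 1) + b * (x\<^sup>2 + 1) + e * (x\<^sup>2 + 1)"
      by (intro add_mono mult_left_mono) auto
    then show ?thesis by (simp add: algebra_simps)
  qed
  have "(load d x)\<^sup>2 \<le> 1600 * (x\<^sup>2 + 1)" for x
    using quad[of 1600 x 0 0] by (simp add: power_mult_distrib)
  then have sq': "(\<integral>\<^sup>+x. of_nat ((load d x)\<^sup>2) \<partial>measure_pmf F) < \<infinity>"
    by (rule nn_integral_quadratic_less_top[OF sq])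
  define O' where "O' D = overshoot (load d) 1 D + overshoot (load d) (-1) D" for D
  have [measurable]: "O' \<in> borel_measurable (config_space F)" unfolding O'_def[abs_def] by measurable
  have O': "(\<integral>\<^sup>+D. O' D \<partial>config_space F) < \<infinity>"
    unfolding O'_def using nn_integral_overshoot_less_top[OF _ mean sq', of 1]
      nn_integral_overshoot_less_top[OF _ mean sq', of "-1"]
    by (subst nn_integral_add) (auto simp: less_top[symmetric])
  have spread: "spread d D = of_nat (load d (D 0)) + O' D" for D by (simp add: spread_def O'_def)
  have lin: "(\<integral>\<^sup>+x. of_nat (load d x) \<partial>measure_pmf F) < \<infinity>"
  proof (rule nn_integral_quadratic_less_top[OF sq])
    show "load d x \<le> 40 * (x\<^sup>2 + 1)" for x using quad[of 0 x 40 0] by simp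
  qed
  show sp: "(\<integral>\<^sup>+D. spread d D \<partial>config_space F) < \<infinity>"
    unfolding spread using lin O'
    by (subst nn_integral_add) (auto simp: nn_integral_config_coord'[where f="\<lambda>x. of_nat (load d x)"]
        less_top[symmetric] simp del: of_nat_mult)
  \<comment> \<open>\<open>?p\<close> collects what depends on \<open>D 0\<close> alone,
    \<open>?q\<close> is the factor of the independent part \<open>O'\<close>.\<close>
  let ?p = "\<lambda>x. (x - d + 2) * (load d x + 2)" and ?q = "\<lambda>x. x - d + 2"
  have p: "(\<integral>\<^sup>+x. of_nat (?p x) \<partial>measure_pmf F) < \<infinity>"
  proof (rule nn_integral_quadratic_less_top[OF sq])
    fix x
    have "?p x = 40 * (x - d)\<^sup>2 + 82 * (x - d) + 4"
      by (simp add: power2_eq_square distrib_left distrib_right)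
    then show "?p x \<le> 126 * (x\<^sup>2 + 1)" using quad[of 40 x 82 4] by simp
  qed
  have q: "(\<integral>\<^sup>+x. of_nat (?q x) \<partial>measure_pmf F) < \<infinity>"
  proof (rule nn_integral_quadratic_less_top[OF sq])
    show "?q x \<le> 3 * (x\<^sup>2 + 1)" for x using quad[of 0 x 1 2] by simp
  qed
  have O'_update: "O' (D(0 := x)) = O' D" for D x by (simp add: O'_def overshoot_update)
  have "(\<integral>\<^sup>+D. of_nat (trunc d D 0 + 2) * (spread d D + 2) \<partial>config_space F)
      = (\<integral>\<^sup>+D. of_nat (?p (D 0)) + of_nat (?q (D 0)) * O' D \<partial>config_space F)"
  proof (intro nn_integral_cong)
    fix D
    have "spread d D + 2 = of_nat (load d (D 0) + 2) + O' D"
      by (simp add: spread add_ac del: of_nat_mult)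
    then show "of_nat (trunc d D 0 + 2) * (spread d D + 2) = of_nat (?p (D 0)) + of_nat (?q (D 0)) * O' D"
      by (simp only: trunc_def of_nat_mult distrib_left[where 'a=ennreal])
  qed
  also have "\<dots> = (\<integral>\<^sup>+x. of_nat (?p x) \<partial>measure_pmf F)
      + (\<integral>\<^sup>+x. of_nat (?q x) \<partial>measure_pmf F) * (\<integral>\<^sup>+D. O' D \<partial>config_space F)"
  proof -
    have "(\<integral>\<^sup>+D. of_nat (?q (D 0)) * O' D \<partial>config_space F)
        = (\<integral>\<^sup>+x. of_nat (?q x) \<partial>measure_pmf F) * (\<integral>\<^sup>+D. O' D \<partial>config_space F)"
      by (rule nn_integral_config_coord) (measurable, rule O'_update)
    moreover have "(\<integral>\<^sup>+D. of_nat (?p (D 0)) \<partial>config_space F) = (\<integral>\<^sup>+x. of_nat (?p x) \<partial>measure_pmf F)"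
      by (rule nn_integral_config_coord')
    moreover have "(\<integral>\<^sup>+D. of_nat (?p (D 0)) + of_nat (?q (D 0)) * O' D \<partial>config_space F)
        = (\<integral>\<^sup>+D. of_nat (?p (D 0)) \<partial>config_space F) + (\<integral>\<^sup>+D. of_nat (?q (D 0)) * O' D \<partial>config_space F)"
      by (rule nn_integral_add) measurable
    ultimately show ?thesis by (simp only:)
  qed
  also have "\<dots> < \<infinity>" 
    using p q O' by (simp only: infinity_ennreal_def ennreal_add_less_top ennreal_mult_less_top) blast
  finally have 1: "(\<integral>\<^sup>+D. of_nat (trunc d D 0 + 2) * (spread d D + 2) \<partial>config_space F) < \<infinity>" .
  have m2 [measurable]: "(\<lambda>D. gap w {x. high d D x} k b) \<in> borel_measurable (config_space F)" for w k b
    by (intro measurable_gap) (simp add: high_def)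
  have m3 [measurable]: "(\<lambda>D. gap w {x. \<not> claimed d D x \<and> D x \<in> {j..d}} k b) \<in> borel_measurable (config_space F)" for w j k b
    by (intro measurable_gap) simp
  have 2: "(\<integral>\<^sup>+D. (if D 0 \<in> {d<..} then (\<Sum>b\<in>UNIV. gap Suc {x. high d D x} (d div 2 + 1) b) else 0) \<partial>config_space F) < \<infinity>"
  proof (rule nn_integral_config_if_less_top)
    assume "measure_pmf.prob F {d<..} > 0"
    from nn_integral_gap_high_less_top[OF this]
    show "(\<integral>\<^sup>+D. (\<Sum>b\<in>UNIV. gap Suc {x. high d D x} (d div 2 + 1) b) \<partial>config_space F) < \<infinity>"
      by (subst nn_integral_sum[OF m2]) (simp add: UNIV_bool)
  qed measurable
  have 3: "(\<integral>\<^sup>+D. (if D 0 \<in> {j..d} then (\<Sum>b\<in>UNIV. gap (\<lambda>_. 1) {x. \<not> claimed d D x \<and> D x \<in> {j..d}} (2 * j - 1) b) else 0)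
      \<partial>config_space F) < \<infinity>" for j
  proof (rule nn_integral_config_if_less_top)
    assume "measure_pmf.prob F {j..d} > 0"
    from nn_integral_gap_unclaimed_less_top[OF this sp]
    show "(\<integral>\<^sup>+D. (\<Sum>b\<in>UNIV. gap (\<lambda>_. 1) {x. \<not> claimed d D x \<and> D x \<in> {j..d}} (2 * j - 1) b) \<partial>config_space F) < \<infinity>"
      by (subst nn_integral_sum[OF m3]) (simp add: UNIV_bool)
  qed measurable
  define t1 where "t1 D = of_nat (trunc d D 0 + 2) * (spread d D + 2)" for D
  define t2 where "t2 D = (if D 0 \<in> {d<..} then (\<Sum>b\<in>UNIV. gap Suc {x. high d D x} (d div 2 + 1) b) else 0)" for D
  define t3 where "t3 j D = (if D 0 \<in> {j..d} then
    (\<Sum>b\<in>UNIV. gap (\<lambda>_. 1) {x. \<not> claimed d D x \<and> D x \<in> {j..d}} (2 * j - 1) b) else 0)" for j D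
  have [measurable]: "t1 \<in> borel_measurable (config_space F)"
    unfolding t1_def[abs_def] trunc_def by measurable
  have [measurable]: "(\<lambda>D. D 0) \<in> borel_measurable (config_space F)"
    by (rule measurable_compose[OF measurable_config_coord]) simp
  have [measurable]: "t2 \<in> borel_measurable (config_space F)"
    unfolding t2_def[abs_def] by measurable
  have [measurable]: "t3 j \<in> borel_measurable (config_space F)" for j
    unfolding t3_def[abs_def] by measurable
  have "(\<integral>\<^sup>+D. T_bound d D \<partial>config_space F) = (\<integral>\<^sup>+D. t1 D + t2 D + (\<Sum>j\<in>{1..d}. t3 j D) \<partial>config_space F)"
    unfolding T_bound_def t1_def t2_def t3_def ..
  also have "\<dots> = (\<integral>\<^sup>+D. t1 D \<partial>config_space F) + (\<integral>\<^sup>+D. t2 D \<partial>config_space F)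
      + (\<Sum>j\<in>{1..d}. \<integral>\<^sup>+D. t3 j D \<partial>config_space F)"
    by (simp add: nn_integral_add nn_integral_sum)
  also have "\<dots> < \<infinity>"
    using 1 2 3 unfolding t1_def[symmetric] t2_def[symmetric] t3_def[symmetric] by simp
  finally show "(\<integral>\<^sup>+D. T_bound d D \<partial>config_space F) < \<infinity>" .
qed

theorem theorem4p1:
  fixes F :: "nat pmf"
  assumes "pmf F 0 = 0"
    and "(\<integral>\<^sup>+ n. ennreal (real n ^ 2) \<partial>measure_pmf F) < \<infinity>"
  shows "\<exists>d0::nat. \<forall>d::nat. even d \<and> d \<ge> d0 \<longrightarrow>
           (AE D in config_space F. \<forall>i. claimed d D i \<longrightarrow> finite (clust d D i))
         \<and> expected_T F d < \<infinity>"
proof -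
  have sq: "(\<integral>\<^sup>+x. of_nat (x\<^sup>2) \<partial>measure_pmf F) < \<infinity>"
    using assms(2) by (simp only: ennreal_of_nat_eq_real_of_nat of_nat_power)
  \<comment> \<open>\<open>d (x - d) \<le> x^2\<close>, so the mean of the truncated degree is at most the second moment over \<open>d\<close>.\<close>
  then have "80 * (\<integral>\<^sup>+x. of_nat (x\<^sup>2) \<partial>measure_pmf F) < (\<infinity>::ennreal)"
    by (simp add: ennreal_mult_less_top)
  then obtain d1 where d1: "80 * (\<integral>\<^sup>+x. of_nat (x\<^sup>2) \<partial>measure_pmf F) \<le> (of_nat d1 :: ennreal)"
    by (rule ennreal_nat_upper)
  show ?thesis
  \<comment> \<open>The 80 is twice the factor 40 in \<open>load\<close>, as the drift condition
    concerns \<open>2 * load d x\<close>. The successor makes \<open>d\<close> positive, so that it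
    can be cancelled.\<close>
  proof (intro exI[of _ "Suc d1"] allI impI conjI)
    fix d assume "even d \<and> Suc d1 \<le> d"
    then have d: "d > 0" "d1 \<le> d" by auto
    have dx: "d * (2 * load d x) \<le> 80 * x\<^sup>2" for x
    proof (cases "d \<le> x")
      case True
      then have "d * (x - d) \<le> x * x" by (intro mult_mono) auto
      then show ?thesis by (simp add: power2_eq_square)
    qed simp
    have "of_nat d * (\<integral>\<^sup>+x. of_nat (2 * load d x) \<partial>measure_pmf F)
        = (\<integral>\<^sup>+x. of_nat (d * (2 * load d x)) \<partial>measure_pmf F)"
      by (subst nn_integral_cmult[symmetric]) (auto simp del: of_nat_mult simp: of_nat_mult[of d])
    also have "\<dots> \<le> (\<integral>\<^sup>+x. of_nat (80 * x\<^sup>2) \<partial>measure_pmf F)"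
      by (intro nn_integral_mono of_nat_mono dx)
    also have "\<dots> = 80 * (\<integral>\<^sup>+x. of_nat (x\<^sup>2) \<partial>measure_pmf F)"
      by (simp add: nn_integral_cmult del: of_nat_power)
    also have "\<dots> \<le> of_nat d" by (rule order_trans[OF d1]) (simp add: d(2))
    finally have "of_nat d * (\<integral>\<^sup>+x. of_nat (2 * load d x) \<partial>measure_pmf F) \<le> (of_nat d * 1 :: ennreal)"
      by simp
    then have mean: "(\<integral>\<^sup>+x. of_nat (2 * load d x) \<partial>measure_pmf F) \<le> (1 :: ennreal)"
      using d(1) by (subst (asm) ennreal_mult_le_mult_iff) (auto simp: of_nat_less_top)
    note fin = nn_integral_T_bound_less_top[OF sq mean]
    have "AE D in config_space F. spread d D \<noteq> \<infinity>"
      using fin(1) by (intro nn_integral_noteq_infinite) auto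
    then show "AE D in config_space F. \<forall>i. claimed d D i \<longrightarrow> finite (clust d D i)"
      by eventually_elim (auto intro!: finite_clust simp: less_top)
    show "expected_T F d < \<infinity>"
      using expected_T_le fin(2) by (rule le_less_trans)
  qed
qed

end
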